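(* Let $k$ be a field of characteristic $2$ and let $C/k$ be an elliptic curve in $\mu_4$-normal form, i.e. for some $s\in k$, $$(X_0+X_2)^2=X_1X_3,\qquad s(X_1+X_3)^2=X_0X_2,$$ in $\mathbb{P}^3$, with identity $\mathrm{O}=(1:1:0:1)$. Addition of generic points on $C$ can be carried out in $7\mathbf{M}+2\mathbf{S}$.
   Context: Addition of generic points means: computing projective coordinates of $P+Q$ from projective coordinates of $P$ and $Q$, for $(P,Q)$ in a nonempty open subset of $C\times C$. Costs: $\mathbf{M}$ is a multiplication in $k$ and $\mathbf{S}$ a squaring in $k$; field additions are not counted. An elliptic curve is nonsingular, so $s\neq0$. *)

theory Defs
  imports "HOL-Analysis.Finite_Cartesian_Product" "HOL-Algebra.Algebraic_Closure_Type"
begin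

section \<open>The curve\<close>

text \<open>
  A point of projective 3-space is given by a nonzero coordinate vector, up to scaling.  The
  index type \<open>4\<close> has elements \<open>0, 1, 2, 3\<close> (and \<open>4 = 0\<close>), so coordinates
  are \<open>x $ 0\<close>, ..., \<open>x $ 3\<close>; for this reason \<open>vector\<close>, which starts
  counting at \<open>1\<close>, is not used.
\<close>

type_synonym 'a coords = "'a^4"

definition vec4 :: "'a \<Rightarrow> 'a \<Rightarrow> 'a \<Rightarrow> 'a \<Rightarrow> 'a^4" where
  "vec4 a b c d = (\<chi> i. if i = 0 then a else if i = 1 then b else if i = 2 then c else d)"

definition same_point :: "'a::field^4 \<Rightarrow> 'a^4 \<Rightarrow> bool" where
  "same_point x y \<longleftrightarrow> (\<exists>c. c \<noteq> 0 \<and> y = c *s x)"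

definition mu4_eqs :: "'a::comm_ring_1 \<Rightarrow> 'a^4 \<Rightarrow> bool" where
  "mu4_eqs s x \<longleftrightarrow>
     (x$0 + x$2)^2 = x$1 * x$3 \<and> s * (x$1 + x$3)^2 = x$0 * x$2"

definition mu4_curve :: "'a::field \<Rightarrow> ('a^4) set" where
  "mu4_curve s = {x. x \<noteq> 0 \<and> mu4_eqs s x}"

definition mu4_O :: "'a::field^4" where
  "mu4_O = vec4 1 1 0 1"

text \<open>
  Jacobian criterion over the algebraic closure: at every geometric point the gradients of
  \<open>(X0 + X2)^2 - X1 X3\<close> and \<open>s (X1 + X3)^2 - X0 X2\<close> are linearly
  independent.
\<close>

definition mu4_grad1 :: "'a::field^4 \<Rightarrow> 'a^4" where
  "mu4_grad1 x = vec4 (2 * (x$0 + x$2)) (- x$3) (2 * (x$0 + x$2)) (- x$1)"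

definition mu4_grad2 :: "'a::field \<Rightarrow> 'a^4 \<Rightarrow> 'a^4" where
  "mu4_grad2 s x = vec4 (- x$2) (2 * s * (x$1 + x$3)) (- x$0) (2 * s * (x$1 + x$3))"

definition mu4_nonsingular :: "'k::field \<Rightarrow> bool" where
  "mu4_nonsingular s \<longleftrightarrow>
     (\<forall>x \<in> mu4_curve (to_ac s). \<forall>a b.
        a *s mu4_grad1 x + b *s mu4_grad2 (to_ac s) x = 0 \<longrightarrow> a = 0 \<and> b = 0)"


section \<open>Forms and open subsets\<close>

text \<open>
  A form of degree \<open>d\<close> in four variables is a family of coefficients indexed by
  exponents \<open>\<alpha>\<close> of total degree \<open>d\<close>; \<open>h\<close> is the ring
  homomorphism by which the coefficients act on the ring where the form is evaluated.
\<close>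

definition exps :: "nat \<Rightarrow> (4 \<Rightarrow> nat) set" where
  "exps d = {\<alpha>. (\<Sum>i\<in>UNIV. \<alpha> i) = d}"

lemma finite_exps: "finite (exps d)"
proof (rule finite_subset)
  show "exps d \<subseteq> (UNIV :: 4 set) \<rightarrow>\<^sub>E {..d}"
    by (auto simp: exps_def PiE_def extensional_def intro: member_le_sum)
  show "finite ((UNIV :: 4 set) \<rightarrow>\<^sub>E {..d})"
    by (intro finite_PiE) auto
qed

definition monom4 :: "'a::comm_semiring_1^4 \<Rightarrow> (4 \<Rightarrow> nat) \<Rightarrow> 'a" where
  "monom4 x \<alpha> = (\<Prod>i\<in>UNIV. x$i ^ \<alpha> i)"

definition form_eval ::
    "('c \<Rightarrow> 'a::comm_ring_1) \<Rightarrow> nat \<Rightarrow> ((4 \<Rightarrow> nat) \<Rightarrow> 'c) \<Rightarrow> 'a^4 \<Rightarrow> 'a" where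
  "form_eval h d f x = (\<Sum>\<alpha>\<in>exps d. h (f \<alpha>) * monom4 x \<alpha>)"

definition biform_eval ::
    "('c \<Rightarrow> 'a::comm_ring_1) \<Rightarrow> nat \<Rightarrow> nat \<Rightarrow> ((4 \<Rightarrow> nat) \<Rightarrow> (4 \<Rightarrow> nat) \<Rightarrow> 'c) \<Rightarrow> 'a^4 \<Rightarrow> 'a^4 \<Rightarrow> 'a"
  where "biform_eval h d e f x y =
    (\<Sum>\<alpha>\<in>exps d. \<Sum>\<beta>\<in>exps e. h (f \<alpha> \<beta>) * monom4 x \<alpha> * monom4 y \<beta>)"

text \<open>
  Zariski open subsets of \<open>C \<times> C\<close>, defined over \<open>k\<close> and given by
  their geometric points: the complement of the common zeros of a set of bihomogeneous forms
  with coefficients in \<open>k\<close>.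
\<close>

definition mu4_open_square ::
    "'k::field \<Rightarrow> ('k alg_closure coords \<times> 'k alg_closure coords) set \<Rightarrow> bool" where
  "mu4_open_square s U \<longleftrightarrow> (\<exists>S :: (nat \<times> nat \<times> ((4 \<Rightarrow> nat) \<Rightarrow> (4 \<Rightarrow> nat) \<Rightarrow> 'k)) set.
     U = {(x, y). x \<in> mu4_curve (to_ac s) \<and> y \<in> mu4_curve (to_ac s) \<and>
            (\<exists>(d, e, f) \<in> S. biform_eval to_ac d e f x y \<noteq> 0)})"


section \<open>The group law\<close>

text \<open>
  The group law with identity \<open>O\<close> is the one of the degree zero class group:
  \<open>P + Q = R\<close> iff the divisor \<open>(P) + (Q) - (R) - (O)\<close> is principal.

  Orders of vanishing at \<open>P\<close> are read off from a formal parametrization of the curve: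
  a power series point reducing to \<open>P\<close> at \<open>t = 0\<close> with nonzero tangent vector in
  projective space (the first-order coefficient vector is not a multiple of \<open>P\<close>).  At a
  nonsingular point such a parametrization identifies the completed local ring with the ring of
  power series in \<open>t\<close>, so the order of a form is the subdegree of its pullback, whichever
  parametrization is used.
\<close>

definition mu4_local_param :: "'a::field \<Rightarrow> 'a^4 \<Rightarrow> 'a fps^4 \<Rightarrow> bool" where
  "mu4_local_param s P \<phi> \<longleftrightarrow>
     mu4_eqs (fps_const s) \<phi> \<and>
     (\<chi> i. fps_nth (\<phi>$i) 0) = P \<and>
     (\<nexists>c. (\<chi> i. fps_nth (\<phi>$i) 1) = c *s P)"

text \<open>
  The divisor of the rational function \<open>f / g\<close> on the curve, for forms \<open>f\<close>, \<open>g\<close> of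
  the same degree not vanishing identically on it.  For \<open>s \<noteq> 0\<close> every point
  has a local parametrization, as shown in \<open>mu4_local_param_exists\<close> below, so the
  condition is never vacuous.
\<close>

definition mu4_div_eq ::
    "'a::field \<Rightarrow> nat \<Rightarrow> ((4 \<Rightarrow> nat) \<Rightarrow> 'a) \<Rightarrow> ((4 \<Rightarrow> nat) \<Rightarrow> 'a) \<Rightarrow> ('a^4 \<Rightarrow> int) \<Rightarrow> bool" where
  "mu4_div_eq s d f g D \<longleftrightarrow>
     (\<forall>P \<in> mu4_curve s. \<forall>\<phi>. mu4_local_param s P \<phi> \<longrightarrow>
        form_eval fps_const d f \<phi> \<noteq> 0 \<and> form_eval fps_const d g \<phi> \<noteq> 0 \<and>
        int (subdegree (form_eval fps_const d f \<phi>)) -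
        int (subdegree (form_eval fps_const d g \<phi>)) = D P)"

definition point_div :: "'a::field^4 \<Rightarrow> 'a^4 \<Rightarrow> int" where
  "point_div P Z = (if same_point P Z then 1 else 0)"

text \<open>For an algebraically closed base field:\<close>

definition mu4_is_sum :: "'a::alg_closed_field \<Rightarrow> 'a^4 \<Rightarrow> 'a^4 \<Rightarrow> 'a^4 \<Rightarrow> bool" where
  "mu4_is_sum s P Q R \<longleftrightarrow>
     P \<in> mu4_curve s \<and> Q \<in> mu4_curve s \<and> R \<in> mu4_curve s \<and>
     (\<exists>d f g. mu4_div_eq s d f g
        (\<lambda>Z. point_div P Z + point_div Q Z - point_div R Z - point_div mu4_O Z))"


section \<open>Straight-line programs\<close>

text \<open>
  Each instruction appends its result to the list of registers and refers to earlier registers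
  by position.  Constants from \<open>k\<close> may be loaded freely, but multiplying by one is an
  ordinary multiplication.
\<close>

datatype 'k instr =
    Const 'k
  | Add nat nat
  | is_Mult: Mult nat nat
  | is_Square: Square nat

primrec instr_result :: "('k \<Rightarrow> 'a::comm_ring_1) \<Rightarrow> 'a list \<Rightarrow> 'k instr \<Rightarrow> 'a" where
  "instr_result h r (Const c) = h c"
| "instr_result h r (Add i j) = r ! i + r ! j"
| "instr_result h r (Mult i j) = r ! i * r ! j"
| "instr_result h r (Square i) = (r ! i)^2"

primrec run :: "('k \<Rightarrow> 'a::comm_ring_1) \<Rightarrow> 'k instr list \<Rightarrow> 'a list \<Rightarrow> 'a list" where
  "run h [] r = r"
| "run h (p # ps) r = run h ps (r @ [instr_result h r p])"

primrec instr_ok :: "nat \<Rightarrow> 'k instr \<Rightarrow> bool" where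
  "instr_ok n (Const c) \<longleftrightarrow> True"
| "instr_ok n (Add i j) \<longleftrightarrow> i < n \<and> j < n"
| "instr_ok n (Mult i j) \<longleftrightarrow> i < n \<and> j < n"
| "instr_ok n (Square i) \<longleftrightarrow> i < n"

primrec prog_ok :: "nat \<Rightarrow> 'k instr list \<Rightarrow> bool" where
  "prog_ok n [] \<longleftrightarrow> True"
| "prog_ok n (p # ps) \<longleftrightarrow> instr_ok n p \<and> prog_ok (Suc n) ps"

definition num_M :: "'k instr list \<Rightarrow> nat" where
  "num_M ps = length (filter is_Mult ps)"

definition num_S :: "'k instr list \<Rightarrow> nat" where
  "num_S ps = length (filter is_Square ps)"

definition eval_prog ::
    "('k \<Rightarrow> 'a::comm_ring_1) \<Rightarrow> 'k instr list \<Rightarrow> (4 \<Rightarrow> nat) \<Rightarrow> 'a^4 \<Rightarrow> 'a^4 \<Rightarrow> 'a^4" where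
  "eval_prog h ps out x y =
     (\<chi> i. run h ps [x$0, x$1, x$2, x$3, y$0, y$1, y$2, y$3] ! out i)"

definition generic_addition_cost :: "'k::field \<Rightarrow> nat \<Rightarrow> nat \<Rightarrow> bool" where
  "generic_addition_cost s m n \<longleftrightarrow>
     (\<exists>ps out U.
        prog_ok 8 ps \<and> (\<forall>i. out i < 8 + length ps) \<and> num_M ps = m \<and> num_S ps = n \<and>
        mu4_open_square s U \<and> U \<noteq> {} \<and>
        (\<forall>(x, y) \<in> U. mu4_is_sum (to_ac s) x y (eval_prog to_ac ps out x y)))"


section \<open>Existence of local parametrizations\<close>

definition fps_agree :: "nat \<Rightarrow> 'a::comm_ring_1 fps \<Rightarrow> 'a fps \<Rightarrow> bool" where
  "fps_agree n a b \<longleftrightarrow> (\<forall>i<n. fps_nth a i = fps_nth b i)"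

lemma fps_agree_refl: "fps_agree n a a"
  by (simp add: fps_agree_def)

lemma fps_agree_add: "fps_agree n a b \<Longrightarrow> fps_agree n c d \<Longrightarrow> fps_agree n (a + c) (b + d)"
  by (simp add: fps_agree_def)

lemma fps_agree_diff: "fps_agree n a b \<Longrightarrow> fps_agree n c d \<Longrightarrow> fps_agree n (a - c) (b - d)"
  by (simp add: fps_agree_def)

lemma fps_agree_mult: "fps_agree n a b \<Longrightarrow> fps_agree n c d \<Longrightarrow> fps_agree n (a * c) (b * d)"
  by (auto simp: fps_agree_def fps_mult_nth intro!: sum.cong)

lemma fps_agree_power: "fps_agree n a b \<Longrightarrow> fps_agree n (a ^ m) (b ^ m)"
  by (induction m) (auto intro: fps_agree_mult fps_agree_refl)

lemma fps_agree_X: "fps_agree n a b \<Longrightarrow> fps_agree (Suc n) (fps_X * a) (fps_X * b)"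
  by (auto simp: fps_agree_def)

lemmas fps_agree_intros =
  fps_agree_refl fps_agree_add fps_agree_diff fps_agree_mult fps_agree_power

lemma fps_fixpoint:
  fixes A B :: "'a::comm_ring_1 fps" and F :: "'a fps \<Rightarrow> 'a fps"
  assumes F: "\<And>a b n. fps_agree n a b \<Longrightarrow> fps_agree n (F a) (F b)"
  obtains u where "u = A + B * (fps_X * F u)"
proof -
  define T where "T u = A + B * (fps_X * F u)" for u
  have T: "fps_agree (Suc n) (T a) (T b)" if "fps_agree n a b" for a b n
    unfolding T_def by (intro fps_agree_add fps_agree_mult fps_agree_refl fps_agree_X F that)
  define a where "a n = (T ^^ n) 0" for n
  have aS: "a (Suc n) = T (a n)" for n by (simp add: a_def)
  have step: "fps_agree n (a n) (a (Suc n))" for n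
  proof (induction n)
    case 0
    show ?case by (simp add: fps_agree_def)
  next
    case (Suc n)
    show ?case using T[OF Suc] by (simp only: aS)
  qed
  have stable: "fps_agree n (a m) (a n)" if "n \<le> m" for n m
    using that
  proof (induction m rule: dec_induct)
    case base
    show ?case by (rule fps_agree_refl)
  next
    case (step m)
    thus ?case using \<open>\<And>n. fps_agree n (a n) (a (Suc n))\<close>[of m]
      by (auto simp: fps_agree_def)
  qed
  define u where "u = Abs_fps (\<lambda>n. fps_nth (a (Suc n)) n)"
  have un: "fps_agree n u (a n)" for n
    unfolding fps_agree_def
  proof (intro allI impI)
    fix i assume "i < n"
    thus "fps_nth u i = fps_nth (a n) i"
      using stable[of "Suc i" n] by (simp add: u_def fps_agree_def)
  qed
  have "fps_nth u i = fps_nth (T u) i" for i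
    using T[OF un[of i]] un[of "Suc i"] by (simp add: aS fps_agree_def)
  hence "u = A + B * (fps_X * F u)" by (simp add: fps_eq_iff T_def)
  thus ?thesis using that by blast
qed

lemma vec4_nth [simp]:
  "vec4 a b c d $ 0 = a" "vec4 a b c d $ 1 = b" "vec4 a b c d $ 2 = c" "vec4 a b c d $ 3 = d"
  by (simp_all add: vec4_def)

lemma UNIV_4': "(UNIV :: 4 set) = {0, 1, 2, 3}"
  by (rule card_eq_UNIV_imp_eq_UNIV[symmetric]) simp_all

lemma coords_eq_iff: "x = y \<longleftrightarrow> x$0 = y$0 \<and> x$1 = y$1 \<and> x$2 = y$2 \<and> x$3 = y$3"
  for x y :: "'a^4"
proof -
  have "x = y \<longleftrightarrow> (\<forall>i\<in>UNIV. x$i = y$i)" by (simp add: vec_eq_iff)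
  thus ?thesis unfolding UNIV_4' by simp
qed

lemma mu4_eqs_scale: "mu4_eqs s x \<Longrightarrow> mu4_eqs s (c *s x)"
proof -
  assume x: "mu4_eqs s x"
  have "c^2 * (x$0 + x$2)^2 = c^2 * (x$1 * x$3)" "c^2 * (s * (x$1 + x$3)^2) = c^2 * (x$0 * x$2)"
    using x by (simp_all add: mu4_eqs_def)
  thus ?thesis by (simp add: mu4_eqs_def power2_eq_square algebra_simps)
qed

lemma mu4_eqs_affine:
  fixes s :: "'a::comm_ring_1"
  assumes two: "(2::'a) = 0" and w: "w^2 + l * w = s * l^3 + 1"
  shows "mu4_eqs s (vec4 (s * l^2) (w + s * l^2) 1 (w + s * l^2 + l))"
proof -
  have "(s * l^2 + 1)^2 - (w + s * l^2) * (w + s * l^2 + l) =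
        2 * (s * l^2 - w * s * l^2 - s * l^3) - (w^2 + l * w - (s * l^3 + 1))"
    by (simp add: power2_eq_square power3_eq_cube algebra_simps)
  hence "(s * l^2 + 1)^2 = (w + s * l^2) * (w + s * l^2 + l)"
    using two w by simp
  moreover have "s * (w + s * l^2 + (w + s * l^2 + l))^2 =
      s * (2 * (w + s * l^2) + l)^2"
    by (simp add: algebra_simps)
  ultimately show ?thesis
    using two by (simp add: mu4_eqs_def)
qed

lemma mu4_eqs_affine_O:
  fixes s :: "'a::comm_ring_1"
  assumes two: "(2::'a) = 0" and a: "a * c = s * (1 + a + c)^4"
  shows "mu4_eqs s (vec4 a 1 c ((a + c)^2))"
proof -
  have "1 + (a + c)^2 = (1 + a + c)^2 - 2 * (a + c)"
    by (simp add: power2_eq_square algebra_simps)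
  hence "(1 + (a + c)^2)^2 = (1 + a + c)^4"
    using two by (simp flip: power_mult)
  thus ?thesis using a by (simp add: mu4_eqs_def)
qed

theorem mu4_local_param_exists:
  fixes s :: "'a::field"
  assumes char: "CHAR('a) = 2" and s: "s \<noteq> 0" and P: "P \<in> mu4_curve s"
  shows "\<exists>\<phi>. mu4_local_param s P \<phi>"
proof -
  have two: "(2::'a) = 0"
    using of_nat_CHAR[where ?'a = 'a] by (simp add: char)
  have dbl: "x + x = 0" for x :: 'a
    using two by (metis mult_2 mult_zero_left)
  have neg: "- x = x" for x :: 'a
    using dbl[of x] by (simp add: eq_neg_iff_add_eq_0 add_eq_0_iff)
  have two': "(2::'a fps) = 0"
    by (simp add: numeral_fps_const two)
  have sq: "(x + y)^2 = x^2 + y^2" for x y :: 'a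
    by (simp add: power2_sum two)
  have P_ne: "P \<noteq> 0" and e1: "(P$0 + P$2)^2 = P$1 * P$3"
    and e2: "s * (P$1 + P$3)^2 = P$0 * P$2"
    using P by (auto simp: mu4_curve_def mu4_eqs_def)
  show ?thesis
  proof (cases "P$2 = 0")
    case True
    have "P$1 + P$3 = 0" using e2 True s by simp
    hence P13: "P$3 = P$1" using neg[of "P$1"] by (simp add: add_eq_0_iff)
    have "(P$0 + P$1)^2 = P$0^2 + P$1^2" by (rule sq)
    also have "\<dots> = 0" using e1 True P13 dbl by (simp add: power2_eq_square)
    finally have "P$0 + P$1 = 0" by simp
    hence P01: "P$1 = P$0" using neg[of "P$0"] by (simp add: add_eq_0_iff)
    have P0: "P$0 \<noteq> 0"
      using P_ne True P13 P01 by (auto simp: coords_eq_iff)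
    define F where "F u = fps_const s * fps_X^2 * (1 + u)^4 - u" for u
    obtain u where "u = 0 + 1 * (fps_X * F u)"
      by (rule fps_fixpoint[of F 0 1]) (auto simp: F_def intro!: fps_agree_intros)
    hence u: "u = fps_X * F u" by simp
    define a where "a = 1 + (fps_X :: 'a fps)"
    define c where "c = fps_X * u"
    have "a * c - fps_const s * (1 + a + c - 2)^4 = fps_X * (u - fps_X * F u)"
      by (simp add: a_def c_def F_def power_numeral_reduce algebra_simps)
    also have "\<dots> = 0" using u by simp
    finally have "a * c = fps_const s * (1 + a + c)^4" using two' by simp
    from mu4_eqs_scale[OF mu4_eqs_affine_O[OF two' this], of "fps_const (P$0)"]
    have eqs: "mu4_eqs (fps_const s) (fps_const (P$0) *s vec4 a 1 c ((a + c)^2))" .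
    have "mu4_local_param s P (fps_const (P$0) *s vec4 a 1 c ((a + c)^2))"
      unfolding mu4_local_param_def
      using eqs True P0 P01 P13
      by (auto simp: coords_eq_iff a_def c_def power2_eq_square)
    thus ?thesis by blast
  next
    case False
    define l0 where "l0 = (P$1 + P$3) / P$2"
    define w0 where "w0 = (P$0 + P$1) / P$2"
    define q where "q = P$2"
    have q: "q \<noteq> 0" using False by (simp add: q_def)
    have P3: "P$3 = q * (w0 + s * l0^2 + l0)" and P0: "P$0 = q * (s * l0^2)"
      and P1: "P$1 = q * (w0 + s * l0^2)"
    proof -
      show 0: "P$0 = q * (s * l0^2)"
        using e2 q by (simp add: l0_def q_def power2_eq_square field_simps)
      have "q * w0 = P$0 + P$1" using q by (simp add: w0_def q_def)
      hence "q * (w0 + s * l0^2) = P$0 + P$1 + P$0" by (simp add: 0 distrib_left)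
      also have "\<dots> = P$1" using dbl[of "P$0"] by (simp add: algebra_simps)
      finally show 1: "P$1 = q * (w0 + s * l0^2)" by simp
      have "q * l0 = P$1 + P$3" using q by (simp add: l0_def q_def)
      hence "q * (w0 + s * l0^2 + l0) = P$1 + (P$1 + P$3)"
        by (simp add: distrib_left flip: 1) (simp add: 1 distrib_left)
      also have "\<dots> = P$3" using dbl[of "P$1"] by (simp flip: add.assoc)
      finally show "P$3 = q * (w0 + s * l0^2 + l0)" by simp
    qed
    have "q^2 * (s * l0^2 + 1)^2 = q^2 * ((w0 + s * l0^2) * (w0 + s * l0^2 + l0))"
      using e1 unfolding P0 P1 P3 q_def[symmetric]
      by (simp add: power2_eq_square algebra_simps)
    hence "(s * l0^2 + 1)^2 = (w0 + s * l0^2) * (w0 + s * l0^2 + l0)" using q by simp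
    moreover have "(s * l0^2 + 1)^2 - (w0 + s * l0^2) * (w0 + s * l0^2 + l0) =
        2 * (s * l0^2 - w0 * s * l0^2 - s * l0^3) - (w0^2 + l0 * w0 - (s * l0^3 + 1))"
      by (simp add: power2_eq_square power3_eq_cube algebra_simps)
    ultimately have w0: "w0^2 + l0 * w0 = s * l0^3 + 1" using two by simp
    define \<psi> where "\<psi> l w = fps_const q *s
        vec4 (fps_const s * l^2) (w + fps_const s * l^2) 1 (w + fps_const s * l^2 + l)"
      for l w :: "'a fps"
    have \<psi>: "mu4_local_param s P (\<psi> l w)"
      if E: "w^2 + l * w = fps_const s * l^3 + 1"
        and l: "fps_nth l 0 = l0" and w: "fps_nth w 0 = w0"
        and d: "fps_nth l 1 = 1 \<or> (fps_nth l 0 = 0 \<and> fps_nth l 1 = 0 \<and> fps_nth w 1 = 1)" for l w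
    proof -
      have "mu4_eqs (fps_const s) (\<psi> l w)"
        unfolding \<psi>_def by (rule mu4_eqs_scale[OF mu4_eqs_affine[OF two' E]])
      moreover have "(\<chi> i. fps_nth (\<psi> l w $ i) 0) = P"
        by (simp add: coords_eq_iff \<psi>_def P0 P1 P3 l w power2_eq_square flip: q_def)
      moreover have "(\<chi> i. fps_nth (\<psi> l w $ i) 1) \<noteq> c *s P" for c
      proof
        assume eq: "(\<chi> i. fps_nth (\<psi> l w $ i) 1) = c *s P"
        hence "c = 0" using q
          by (auto simp: coords_eq_iff \<psi>_def simp flip: q_def)
        with eq have "fps_nth (\<psi> l w $ 1) 1 = 0" "fps_nth (\<psi> l w $ 3) 1 = 0"
          by (auto simp: coords_eq_iff)
        thus False using d q
          by (auto simp: \<psi>_def power2_eq_square algebra_simps)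
      qed
      ultimately show ?thesis by (auto simp: mu4_local_param_def)
    qed
    show ?thesis
    proof (cases "l0 = 0")
      case l0: False
      define F where "F u = fps_const s * (fps_const l0 + fps_X) - u - u^2" for u
      define A where "A = fps_const (inverse l0) * (fps_const (s * l0^2) - fps_const w0)"
      obtain u where u: "u = A + fps_const (inverse l0) * (fps_X * F u)"
        by (rule fps_fixpoint[of F A "fps_const (inverse l0)"])
           (auto simp: F_def intro!: fps_agree_intros)
      have inv: "fps_const l0 * fps_const (inverse l0) = 1" using l0 by simp
      have "fps_const l0 * u =
          fps_const l0 * fps_const (inverse l0) * (fps_const (s * l0^2) - fps_const w0 + fps_X * F u)"
        by (subst u) (simp only: A_def algebra_simps)
      hence lu: "fps_const l0 * u = fps_const (s * l0^2) - fps_const w0 + fps_X * F u"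
        unfolding inv by simp
      hence lu': "fps_const l0 * u = fps_const s * fps_const l0^2 - fps_const w0 + fps_X * F u"
        by (simp add: fps_const_power fps_const_mult)
      have w0': "fps_const w0^2 + fps_const l0 * fps_const w0 = fps_const s * fps_const l0^3 + 1"
        using arg_cong[OF w0, of fps_const]
        by (simp add: fps_const_power fps_const_mult flip: fps_const_add)
      define l where "l = fps_const l0 + fps_X"
      define w where "w = fps_const w0 + fps_X * u"
      have "w^2 + l * w - (fps_const s * l^3 + 1) =
          (fps_const w0^2 + fps_const l0 * fps_const w0 - (fps_const s * fps_const l0^3 + 1))
          + fps_X * (fps_const l0 * u - (fps_const s * fps_const l0^2 - fps_const w0 + fps_X * F u))
          + 2 * (fps_const w0 * fps_X * u
                 - fps_const s * (fps_const l0^2 * fps_X + fps_const l0 * fps_X^2))"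
        by (simp add: l_def w_def F_def power2_eq_square power3_eq_cube algebra_simps)
      also have "\<dots> = 0"
        unfolding w0' lu' two' by simp
      finally have "w^2 + l * w = fps_const s * l^3 + 1" by simp
      hence "mu4_local_param s P (\<psi> l w)" by (rule \<psi>) (simp_all add: l_def w_def)
      thus ?thesis by blast
    next
      case l0: True
      have "(w0 + 1)^2 = 0" using w0 l0 dbl[of 1] by (simp add: sq)
      hence "w0 + 1 = 0" by simp
      hence w01: "w0 = 1" using neg[of 1] by (simp add: eq_neg_iff_add_eq_0 flip: eq_neg_iff_add_eq_0)
      define F where "F u = 1 - u - fps_const s * fps_X * u^3" for u
      obtain u where "u = 0 + 1 * (fps_X * F u)"
        by (rule fps_fixpoint[of F 0 1]) (auto simp: F_def intro!: fps_agree_intros)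
      hence u: "u = fps_X * F u" by simp
      define l where "l = fps_X * u"
      define w where "w = 1 + (fps_X :: 'a fps)"
      have "w^2 + l * w - (fps_const s * l^3 + 1) =
          fps_X * (u - fps_X * F u) + 2 * (fps_X + fps_X^2 - fps_const s * l^3)"
        by (simp add: l_def w_def F_def power2_eq_square power3_eq_cube algebra_simps)
      also have "\<dots> = 0" unfolding two' using u by simp
      finally have "w^2 + l * w = fps_const s * l^3 + 1" by simp
      moreover have "fps_nth u 0 = 0" by (subst u) simp
      ultimately have "mu4_local_param s P (\<psi> l w)"
        by (intro \<psi>) (simp_all add: l_def w_def l0 w01)
      thus ?thesis by blast
    qed
  qed
qed

end

theory Submission
  imports Defs
begin

text \<open>
  With \<open>V0 = X1 Y0\<close>, \<open>V1 = X0 Y3\<close>, \<open>V2 = X3 Y2\<close>, \<open>V3 = X2 Y1\<close> the sum of two generic points is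
  \<open>(V0 V1 + V2 V3 : (V0 + V2)^2 : V0 V3 + V2 V1 : (V1 + V3)^2)\<close>, and since
  \<open>(V0 V1 + V2 V3) + (V0 V3 + V2 V1) = (V0 + V2) (V1 + V3)\<close> this takes four products for the
  \<open>Vi\<close>, three further products and two squarings.  Unlike the addition law in the \<open>Xi Yi\<close>, it
  involves no multiplication by \<open>s\<close>.

  For correctness, put \<open>l = (X1 + X3)/X2\<close> and \<open>w = (X0 + X1)/X2\<close>; the curve becomes
  \<open>w^2 + l w = s l^3 + 1\<close> with \<open>O\<close> at infinity and \<open>-(l, w) = (l, w + l)\<close>.  If \<open>R\<close> is the computed
  point, then \<open>P\<close>, \<open>Q\<close>, \<open>-R\<close> lie on a line \<open>w = a l + b\<close>, and
  \<open>(w + a l + b) / (l + l(R))\<close> has divisor \<open>P + Q - R - O\<close>.  Orders of the line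
  are obtained from its norm
  \<open>(w + a l + b) (w + l + a l + b) = s (l + l(P)) (l + l(Q)) (l + l(R))\<close>.
\<close>

text \<open>
  \<open>Defs\<close> brings two meanings of \<open>$\<close> into scope; parsing is exponential in the number of
  occurrences unless one is removed.
\<close>
no_notation fps_nth (infixl \<open>$\<close> 75)

section \<open>Characteristic 2 identities: the addition formulas and the norm of a line\<close>

text \<open>Minus signs disappear, and \<open>x + (x + y) = y\<close> cancels equal terms inside
  sums already sorted by associativity and commutativity.\<close>

lemma char2_simps:
  fixes x y :: "'r::comm_ring_1"
  assumes "(2::'r) = 0"
  shows "x + x = 0" "x + (x + y) = y" "- x = x" "x - y = x + y"
proof -
  have dbl: "z + z = 0" for z :: 'r
    unfolding mult_2[symmetric] assms by simp
  have neg: "- z = z" for z :: 'r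
    by (rule minus_unique) (rule dbl)
  show "x + x = 0" by (rule dbl)
  show "- x = x" by (rule neg)
  show "x + (x + y) = y" by (simp add: dbl flip: add.assoc)
  show "x - y = x + y" unfolding diff_conv_add_uminus neg ..
qed

definition mu4_add :: "'a::comm_ring_1^4 \<Rightarrow> 'a^4 \<Rightarrow> 'a^4" where
  "mu4_add x y = vec4
     (x$1 * y$0 * (x$0 * y$3) + x$3 * y$2 * (x$2 * y$1))
     ((x$1 * y$0 + x$3 * y$2)^2)
     (x$1 * y$0 * (x$2 * y$1) + x$3 * y$2 * (x$0 * y$3))
     ((x$0 * y$3 + x$2 * y$1)^2)"

text \<open>Inverse of \<open>l = (X1 + X3)/X2\<close>, \<open>w = (X0 + X1)/X2\<close> on the chart
  \<open>X2 = 1\<close>, where the second quadric reads \<open>X0 = s l^2\<close>.\<close>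

definition mu4_affine :: "'a::field \<Rightarrow> 'a \<Rightarrow> 'a \<Rightarrow> 'a^4" where
  "mu4_affine s l w = vec4 (s * l^2) (w + s * l^2) 1 (w + s * l^2 + l)"

text \<open>If \<open>Z\<close> has affine coordinates \<open>(l3, w3)\<close>, then
  \<open>Z$1 + Z$3 = Z$2 * l3\<close> and \<open>Z$0 + Z$3 = Z$2 * (w3 + l3)\<close>, so this is the
  collinearity of \<open>P\<close>, \<open>Q\<close> and \<open>-R\<close>, multiplied by
  \<open>Z$2\<close>. It holds by expansion: the curve equations lower the powers of
  \<open>w1\<close> and \<open>w2\<close> until equal monomials cancel in pairs.\<close>

lemma mu4_add_collinear:
  fixes s :: "'a::field"
  assumes two: "(2::'a) = 0"
    and P: "w1^2 + l1 * w1 = s * l1^3 + 1" and Q: "w2^2 + l2 * w2 = s * l2^3 + 1"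
    and Z: "Z = mu4_add (mu4_affine s l1 w1) (mu4_affine s l2 w2)"
  shows "(w1 + w2) * (l1 * Z$2 + (Z$1 + Z$3)) = (w1 * Z$2 + (Z$0 + Z$3)) * (l1 + l2)"
proof -
  note c = char2_simps[OF two]
  have E: "w * w = l * w + (s * (l * (l * l)) + 1)" if "w^2 + l * w = s * l^3 + 1" for l w
  proof -
    have "w * w = (w^2 + l * w) + l * w"
      by (simp add: c power2_eq_square add.assoc)
    also have "\<dots> = l * w + (s * (l * (l * l)) + 1)"
      unfolding that by (simp add: power3_eq_cube mult.assoc add.commute)
    finally show ?thesis .
  qed
  \<comment> \<open>The same reduction with a trailing factor \<open>z\<close>, so that it also
    applies inside right-nested products.\<close>
  have E': "w * (w * z) = l * (w * z) + (s * (l * (l * (l * z))) + z)"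
    if "w^2 + l * w = s * l^3 + 1" for l w z
    unfolding mult.assoc[symmetric, of w w z] E[OF that]
    by (simp only: ring_distribs mult.assoc mult_1_left)
  note ww = E[OF P] E[OF Q] E'[OF P] E'[OF Q]
  have sq: "(a + b)^2 = a^2 + b^2" for a b :: 'a
    by (simp add: power2_sum two)
  show ?thesis
    unfolding Z mu4_add_def mu4_affine_def vec4_nth
    apply (simp only: sq power_mult_distrib)
    apply (simp only: power2_eq_square)
    apply (simp only: ring_distribs mult_1_left mult_1_right)
    apply (simp only: mult.assoc mult.commute mult.left_commute ww ring_distribs mult_1_left mult_1_right)
    apply (simp only: add.assoc add.commute add.left_commute c add_0_left add_0_right)
    done
qed

text \<open>A Weierstrass equation free of division, hence valid for points and for power series
  alike. The first quadric gives
  \<open>(x$0 + x$1) * (x$0 + x$3) = x$0 * (x$1 + x$3) + x$2^2\<close>; after multiplication by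
  \<open>x$2\<close> the second quadric replaces \<open>x$0 * x$2\<close>.\<close>

lemma mu4_weierstrass:
  fixes s :: "'r::comm_ring_1"
  assumes two: "(2::'r) = 0" and x: "mu4_eqs s x"
  shows "(x$0 + x$1) * (x$0 + x$1 + (x$1 + x$3)) * x$2 = s * (x$1 + x$3)^3 + x$2^3"
proof -
  note c = char2_simps[OF two]
  have e1: "x$1 * x$3 = x$0 * x$0 + x$2 * x$2" and e2: "x$0 * x$2 = s * (x$1 + x$3)^2"
    using x by (simp_all add: mu4_eqs_def power2_sum two flip: power2_eq_square)
  have "(x$0 + x$1) * (x$0 + x$1 + (x$1 + x$3)) = x$0 * (x$1 + x$3) + x$2 * x$2"
    using e1 by (simp add: algebra_simps c)
  hence "(x$0 + x$1) * (x$0 + x$1 + (x$1 + x$3)) * x$2 =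
      (x$0 * (x$1 + x$3) + x$2 * x$2) * x$2"
    by (rule arg_cong)
  also have "\<dots> = x$0 * x$2 * (x$1 + x$3) + x$2 * x$2 * x$2"
    by (simp add: algebra_simps)
  finally have "(x$0 + x$1) * (x$0 + x$1 + (x$1 + x$3)) * x$2 =
      x$0 * x$2 * (x$1 + x$3) + x$2 * x$2 * x$2" .
  thus ?thesis by (simp add: e2 power2_eq_square power3_eq_cube mult.assoc)
qed

text \<open>Substituting \<open>w = a l + b\<close> into the Weierstrass equation gives a cubic in
  \<open>l\<close>; the hypotheses on \<open>l1\<close>, \<open>l2\<close>, \<open>l3\<close> are
  Vieta's formulas for it. The factor \<open>f + (x$1 + x$3)\<close> is the conjugate of
  \<open>f\<close> under negation.\<close>

lemma mu4_line_norm: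
  fixes s :: "'r::comm_ring_1"
  assumes two: "(2::'r) = 0" and x: "mu4_eqs s x"
    and "s * (l1 + l2 + l3) = a^2 + a" "s * (l1 * l2 + l1 * l3 + l2 * l3) = b"
    and "s * (l1 * l2 * l3) = 1 + b^2"
    and f: "f = x$0 + x$1 + a * (x$1 + x$3) + b * x$2"
  shows "f * (f + (x$1 + x$3)) * x$2 =
    s * ((x$1 + x$3 + l1 * x$2) * (x$1 + x$3 + l2 * x$2) * (x$1 + x$3 + l3 * x$2))"
proof -
  note c = char2_simps[OF two]
  define w l z where "w = x$0 + x$1" and "l = x$1 + x$3" and "z = x$2"
  have w: "w * (w + l) * z = s * l^3 + z^3"
    using mu4_weierstrass[OF two x] by (simp add: w_def l_def z_def)
  have "(w + a * l + b * z) * (w + a * l + b * z + l) * z =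
      w * (w + l) * z + (a^2 + a) * l^2 * z + b * l * z^2 + b^2 * z^3"
    by (simp add: algebra_simps power2_eq_square power3_eq_cube c)
  also have "\<dots> = s * l^3 + (a^2 + a) * l^2 * z + b * l * z^2 + (1 + b^2) * z^3"
    unfolding w by (simp add: algebra_simps)
  also have "\<dots> = s * ((l + l1 * z) * (l + l2 * z) * (l + l3 * z))"
    unfolding assms(3,5)[symmetric] unfolding assms(4)[symmetric]
    by (simp add: algebra_simps power2_eq_square power3_eq_cube)
  finally show ?thesis by (simp add: f w_def l_def z_def)
qed

text \<open>Divided differences: the difference of two root equations, divided by
  \<open>x - t\<close>, is a quadratic condition. The difference of two such conditions, divided by
  \<open>y - z\<close>, determines \<open>a\<close>; then \<open>b\<close> and \<open>c\<close>
  follow.\<close>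

lemma cubic_roots_coeffs:
  fixes s a b c :: "'a::field"
  assumes "s * x^3 + a * x^2 + b * x + c = 0" "s * y^3 + a * y^2 + b * y + c = 0"
    and "s * z^3 + a * z^2 + b * z + c = 0"
    and "x \<noteq> y" "x \<noteq> z" "y \<noteq> z"
  shows "a = - (s * (x + y + z))" "b = s * (x * y + x * z + y * z)" "c = - (s * (x * y * z))"
proof -
  have d: "s * (x^2 + x * t + t^2) + a * (x + t) + b = 0"
    if "s * t^3 + a * t^2 + b * t + c = 0" "x \<noteq> t" for t
  proof -
    have "(x - t) * (s * (x^2 + x * t + t^2) + a * (x + t) + b) =
        (s * x^3 + a * x^2 + b * x + c) - (s * t^3 + a * t^2 + b * t + c)"
      by (simp add: algebra_simps power2_eq_square power3_eq_cube)
    thus ?thesis using that assms(1) by simp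
  qed
  note dy = d[OF assms(2,4)] and dz = d[OF assms(3,5)]
  have "(y - z) * (s * (x + y + z) + a) =
      (s * (x^2 + x * y + y^2) + a * (x + y) + b) - (s * (x^2 + x * z + z^2) + a * (x + z) + b)"
    by (simp add: algebra_simps power2_eq_square)
  hence "s * (x + y + z) + a = 0" using assms(6) dy dz by simp
  thus a: "a = - (s * (x + y + z))" by (simp add: eq_neg_iff_add_eq_0 add.commute)
  have "b = - (s * (x^2 + x * y + y^2) + a * (x + y))"
    by (rule minus_unique[OF dy, symmetric])
  thus b: "b = s * (x * y + x * z + y * z)"
    by (simp add: a algebra_simps power2_eq_square)
  have "c = - (s * x^3 + a * x^2 + b * x)"
    by (rule minus_unique[OF assms(1), symmetric])
  thus "c = - (s * (x * y * z))"
    by (simp add: a b algebra_simps power2_eq_square power3_eq_cube)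
qed

section \<open>Linear forms as coefficient families\<close>

definition unit_exp :: "4 \<Rightarrow> 4 \<Rightarrow> nat" where
  "unit_exp i = (\<lambda>j. if j = i then 1 else 0)"

lemma unit_exp_in_exps: "unit_exp i \<in> exps 1"
  by (simp add: exps_def unit_exp_def)

lemma exps_1: "exps 1 = range unit_exp"
proof (intro antisym subsetI)
  fix \<alpha> assume "\<alpha> \<in> exps 1"
  hence "(\<Sum>i\<in>UNIV. \<alpha> i) = Suc 0" by (simp add: exps_def)
  then obtain i where i: "\<alpha> i = Suc 0" "\<forall>j\<in>UNIV. i \<noteq> j \<longrightarrow> \<alpha> j = 0"
    by (auto simp: sum_eq_Suc0_iff)
  hence "\<alpha> = unit_exp i" by (auto simp: unit_exp_def)
  thus "\<alpha> \<in> range unit_exp" by simp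
qed (auto simp: unit_exp_in_exps[unfolded One_nat_def])

lemma inj_unit_exp: "inj unit_exp"
  by (rule injI) (metis unit_exp_def zero_neq_one)

lemma monom4_unit_exp: "monom4 x (unit_exp i) = x$i"
proof -
  have "monom4 x (unit_exp i) = (\<Prod>j\<in>UNIV. if j = i then x$j else 1)"
    unfolding monom4_def unit_exp_def by (rule prod.cong) auto
  thus ?thesis by simp
qed

text \<open>In degree 1 only the values on \<open>exps 1\<close> reach \<open>form_eval\<close>; at
  \<open>unit_exp i\<close> the sum collapses to \<open>c$i\<close>.\<close>

definition linear_form :: "'a::comm_ring_1^4 \<Rightarrow> (4 \<Rightarrow> nat) \<Rightarrow> 'a" where
  "linear_form c \<alpha> = (\<Sum>i\<in>UNIV. c$i * of_nat (\<alpha> i))"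

lemma form_eval_linear_form:
  "form_eval h 1 (linear_form c) x = h (c$0) * x$0 + h (c$1) * x$1 + h (c$2) * x$2 + h (c$3) * x$3"
proof -
  have "linear_form c (unit_exp i) = c$i" for i
  proof -
    have "linear_form c (unit_exp i) = (\<Sum>j\<in>UNIV. if j = i then c$j else 0)"
      unfolding linear_form_def unit_exp_def by (rule sum.cong) auto
    thus ?thesis by simp
  qed
  hence "form_eval h 1 (linear_form c) x = (\<Sum>i\<in>UNIV. h (c$i) * x$i)"
    unfolding form_eval_def exps_1
    by (subst sum.reindex[OF inj_unit_exp]) (simp add: monom4_unit_exp)
  thus ?thesis unfolding UNIV_4' by (simp add: add.assoc)
qed

section \<open>Points of the curve, local parametrizations and orders of vanishing\<close>

locale mu4_char2 =
  fixes s :: "'a::field"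
  assumes char2: "CHAR('a) = 2" and s_nz: "s \<noteq> 0"
begin

lemma two: "(2::'a) = 0"
  using of_nat_CHAR[where ?'a = 'a] by (simp add: char2)

lemma two_fps: "(2::'a fps) = 0"
  by (simp add: numeral_fps_const two)

lemmas c2 = char2_simps[OF two]

lemma add_eq_0_iff2: "x + y = 0 \<longleftrightarrow> x = (y::'a)"
  using c2 by (metis add_eq_0_iff)

text \<open>The first quadric holds because coordinates 0 and 2 add up to
  \<open>(v0 + v2) * (v1 + v3)\<close>. For the second, the sum of coordinates 1 and 3 is rewritten
  as \<open>t\<close>, since the curve equations turn \<open>s * t^2\<close> into the product of
  coordinates 0 and 2.\<close>

lemma mu4_eqs_add:
  assumes x: "mu4_eqs s x" and y: "mu4_eqs s y"
  shows "mu4_eqs s (mu4_add x y)"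
proof -
  define v0 v1 v2 v3 where v: "v0 = x$1 * y$0" "v1 = x$0 * y$3" "v2 = x$3 * y$2" "v3 = x$2 * y$1"
  have x1: "x$1 * x$3 = (x$0 + x$2)^2" and x2: "x$0 * x$2 = s * (x$1 + x$3)^2"
    and y1: "y$1 * y$3 = (y$0 + y$2)^2" and y2: "y$0 * y$2 = s * (y$1 + y$3)^2"
    using x y by (simp_all add: mu4_eqs_def)
  define t where "t = (x$1 + x$3) * (y$0 + y$2) * (v0 + v2) + (x$0 + x$2) * (y$1 + y$3) * (v1 + v3)"
  have "t = (v0 + v2)^2 + (v1 + v3)^2
      + (y$0 * y$2) * (x$1 + x$3)^2 + (x$1 * x$3) * (y$0 + y$2)^2
      + (x$0 * x$2) * (y$1 + y$3)^2 + (y$1 * y$3) * (x$0 + x$2)^2"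
    by (simp add: t_def v power2_eq_square algebra_simps c2)
  \<comment> \<open>The four mixed terms cancel in pairs: two become
    \<open>s * (x$1 + x$3)^2 * (y$1 + y$3)^2\<close>, the other two
    \<open>(x$0 + x$2)^2 * (y$0 + y$2)^2\<close>.\<close>
  also have "\<dots> = (v0 + v2)^2 + (v1 + v3)^2"
    unfolding x1 x2 y1 y2 by (simp add: ac_simps c2)
  finally have t: "(v0 + v2)^2 + (v1 + v3)^2 = t" ..
  have "(v0 * v1 + v2 * v3) * (v0 * v3 + v2 * v1) = v1 * v3 * (v0 + v2)^2 + v0 * v2 * (v1 + v3)^2"
    by (simp add: power2_eq_square algebra_simps c2)
  also have "v1 * v3 = (x$0 * x$2) * (y$1 * y$3)" by (simp add: v)
  also have "v0 * v2 = (x$1 * x$3) * (y$0 * y$2)" by (simp add: v)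
  also have "(x$0 * x$2) * (y$1 * y$3) * (v0 + v2)^2 + (x$1 * x$3) * (y$0 * y$2) * (v1 + v3)^2 = s * t^2"
    unfolding x1 x2 y1 y2 t_def
    by (simp add: power2_sum two power_mult_distrib) (simp add: algebra_simps)
  finally have "s * ((v0 + v2)^2 + (v1 + v3)^2)^2 = (v0 * v1 + v2 * v3) * (v0 * v3 + v2 * v1)"
    unfolding t ..
  moreover have "(v0 * v1 + v2 * v3 + (v0 * v3 + v2 * v1))^2 = (v0 + v2)^2 * (v1 + v3)^2"
    by (simp add: power2_eq_square algebra_simps)
  ultimately show ?thesis
    by (simp add: mu4_eqs_def mu4_add_def flip: v)
qed

lemma curve_affineE:
  assumes x: "x \<in> mu4_curve s" "x$2 \<noteq> 0"
  obtains l w where "x = x$2 *s mu4_affine s l w" "w^2 + l * w = s * l^3 + 1"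
proof -
  define l where "l = (x$1 + x$3) / x$2"
  define w where "w = (x$0 + x$1) / x$2"
  have q: "x$2 * l = x$1 + x$3" "x$2 * w = x$0 + x$1" using x(2) by (simp_all add: l_def w_def)
  have e: "mu4_eqs s x" using x by (simp add: mu4_curve_def)
  have "x$2^3 * (w^2 + l * w) = (x$2 * w) * (x$2 * w + x$2 * l) * x$2"
    by (simp add: power2_eq_square power3_eq_cube algebra_simps)
  also have "\<dots> = s * (x$2 * l)^3 + x$2^3"
    unfolding q by (rule mu4_weierstrass[OF two e])
  also have "\<dots> = x$2^3 * (s * l^3 + 1)" by (simp add: power_mult_distrib algebra_simps)
  finally have w: "w^2 + l * w = s * l^3 + 1" using x(2) by simp
  have "x$2 * x$0 = s * (x$2 * l)^2"
    using e unfolding q by (simp add: mu4_eqs_def mult.commute)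
  hence "x$2 * x$0 = x$2 * (x$2 * (s * l^2))" by (simp add: power2_eq_square algebra_simps)
  hence x0: "x$0 = x$2 * (s * l^2)" using x(2) by simp
  have x1: "x$1 = x$2 * (w + s * l^2)"
    unfolding distrib_left q x0[symmetric] by (simp add: two)
  have x3: "x$3 = x$2 * (w + s * l^2 + l)"
    unfolding distrib_left[of _ _ l] q x1[symmetric] by (simp flip: add.assoc add: c2)
  show ?thesis
    by (rule that[OF _ w]) (use x0 x1 x3 in \<open>simp add: coords_eq_iff mu4_affine_def\<close>)
qed

text \<open>The second quadric forces \<open>x$1 = x$3\<close>, the first then
  \<open>x$0^2 = x$1^2\<close>, and squaring is injective in characteristic 2.\<close>

lemma curve_at_infinity:
  assumes x: "x \<in> mu4_curve s" "x$2 = 0"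
  shows "x$0 \<noteq> 0" "x = x$0 *s mu4_O"
proof -
  have e: "(x$0)^2 = x$1 * x$3" "s * (x$1 + x$3)^2 = 0"
    using x by (simp_all add: mu4_curve_def mu4_eqs_def)
  hence 3: "x$3 = x$1" using s_nz by (simp add: add_eq_0_iff2)
  have "(x$0 + x$1)^2 = (x$0)^2 + (x$1)^2" by (simp add: power2_sum two)
  also have "\<dots> = 0" unfolding e(1) 3 by (simp add: power2_eq_square c2)
  finally have 1: "x$1 = x$0" by (simp add: add_eq_0_iff2)
  show "x = x$0 *s mu4_O" using x 1 3 by (simp add: coords_eq_iff mu4_O_def)
  show "x$0 \<noteq> 0" using x 1 3 by (auto simp: mu4_curve_def coords_eq_iff)
qed

text \<open>Coefficients of \<open>t^0\<close> and \<open>t^1\<close>. A square has no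
  \<open>t^1\<close> term in characteristic 2, so the linear conditions only see
  \<open>X1 X3\<close> and \<open>X0 X2\<close>.\<close>

lemma local_param_nth:
  assumes "mu4_local_param s Z \<phi>"
  defines "b \<equiv> \<lambda>i. fps_nth (\<phi>$i) 1"
  shows "fps_nth (\<phi>$i) 0 = Z$i" "Z$1 * b 3 = Z$3 * b 1" "Z$0 * b 2 = Z$2 * b 0"
    "\<not> (\<forall>i. b i = k * Z$i)"
proof -
  show 0: "fps_nth (\<phi>$i) 0 = Z$i" for i
    using assms by (auto simp: mu4_local_param_def vec_eq_iff)
  have sq: "fps_nth (u^2) 1 = 0" for u :: "'a fps"
    by (simp add: power2_eq_square mult.commute c2)
  have e: "(\<phi>$0 + \<phi>$2)^2 = \<phi>$1 * \<phi>$3" "fps_const s * (\<phi>$1 + \<phi>$3)^2 = \<phi>$0 * \<phi>$2"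
    using assms by (simp_all add: mu4_local_param_def mu4_eqs_def)
  show "Z$1 * b 3 = Z$3 * b 1"
    using arg_cong[OF e(1), of "\<lambda>f. fps_nth f 1"]
    by (simp only: sq) (simp add: 0 b_def add_eq_0_iff2 mult.commute eq_commute[of 0])
  have "fps_nth (fps_const s * (\<phi>$1 + \<phi>$3)^2) 1 = 0" by (simp only: fps_mult_left_const_nth sq mult_zero_right)
  thus "Z$0 * b 2 = Z$2 * b 0"
    unfolding e(2) by (simp add: 0 b_def add_eq_0_iff2 mult.commute)
  show "\<not> (\<forall>i. b i = k * Z$i)"
    using assms by (auto simp: mu4_local_param_def vec_eq_iff)
qed

text \<open>At an affine point with \<open>l = a\<close> and \<open>a\<close> nonzero,
  \<open>l + a\<close> is a local parameter: if it vanished to order two, the first-order vector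
  would be a multiple of \<open>Z\<close>, which a parametrization forbids.\<close>

lemma subdegree_vertical:
  assumes \<phi>: "mu4_local_param s Z \<phi>" and Z: "Z$2 \<noteq> 0" and a: "a \<noteq> 0"
  defines "v \<equiv> \<phi>$1 + \<phi>$3 + fps_const a * \<phi>$2"
  shows "v \<noteq> 0" "subdegree v = of_bool (Z$1 + Z$3 = a * Z$2)"
proof -
  note n = local_param_nth[OF \<phi>]
  have v0: "fps_nth v 0 = Z$1 + Z$3 + a * Z$2" by (simp add: v_def n)
  have v1: "fps_nth v 1 \<noteq> 0" if e: "Z$1 + Z$3 = a * Z$2"
  proof
    let ?b = "\<lambda>i. fps_nth (\<phi>$i) 1"
    assume "fps_nth v 1 = 0"
    hence b: "?b 1 + ?b 3 = a * ?b 2" by (simp add: v_def add_eq_0_iff2)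
    define k where "k = ?b 2 / Z$2"
    have b2: "?b 2 = k * Z$2" using Z by (simp add: k_def)
    have b0: "?b 0 = k * Z$0" using n(3) Z by (simp add: k_def field_simps)
    \<comment> \<open>The tangent condition exchanges \<open>Z$3 * ?b 1\<close> for
      \<open>Z$1 * ?b 3\<close>; then \<open>Z$1 + Z$3 = a * Z$2\<close> can be cancelled, being
      nonzero.\<close>
    have "(Z$1 + Z$3) * ?b 1 = Z$1 * ?b 1 + Z$1 * ?b 3"
      using n(2) by (simp add: algebra_simps)
    also have "\<dots> = Z$1 * (k * (a * Z$2))" by (simp only: b b2 mult.left_commute flip: distrib_left)
    also have "\<dots> = (Z$1 + Z$3) * (k * Z$1)" by (simp add: e)
    finally have b1: "?b 1 = k * Z$1" using e a Z by simp
    have "(Z$1 + Z$3) * ?b 3 = Z$3 * ?b 1 + Z$3 * ?b 3"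
      using n(2) by (simp add: algebra_simps)
    also have "\<dots> = Z$3 * (k * (a * Z$2))" by (simp only: b b2 mult.left_commute flip: distrib_left)
    also have "\<dots> = (Z$1 + Z$3) * (k * Z$3)" by (simp add: e)
    finally have b3: "?b 3 = k * Z$3" using e a Z by simp
    have "\<forall>i\<in>UNIV. ?b i = k * Z$i" unfolding UNIV_4' using b0 b1 b2 b3 by simp
    thus False using n(4)[of k] by simp
  qed
  show "v \<noteq> 0" using v0 v1 by (cases "Z$1 + Z$3 = a * Z$2") (auto simp: add_eq_0_iff2)
  show "subdegree v = of_bool (Z$1 + Z$3 = a * Z$2)"
  proof (cases "Z$1 + Z$3 = a * Z$2")
    case True
    have "subdegree v = 1"
      by (rule subdegreeI[OF v1[OF True]]) (use v0 True in \<open>simp add: c2\<close>)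
    thus ?thesis using True by simp
  next
    case False
    thus ?thesis using v0 by (simp add: add_eq_0_iff2)
  qed
qed

text \<open>At \<open>O\<close> the line has order 1 and a vertical line order 2, so their quotient
  has a simple pole there.\<close>

lemma subdegree_at_infinity:
  fixes a b l :: 'a
  assumes \<phi>: "mu4_local_param s Z \<phi>" and Z: "Z \<in> mu4_curve s" "Z$2 = 0"
  defines "f \<equiv> \<phi>$0 + \<phi>$1 + fps_const a * (\<phi>$1 + \<phi>$3) + fps_const b * \<phi>$2"
    and "v \<equiv> \<phi>$1 + \<phi>$3 + fps_const l * \<phi>$2"
  shows "f \<noteq> 0" "subdegree f = 1" "v \<noteq> 0" "subdegree v = 2"
proof -
  note n = local_param_nth[OF \<phi>]
  let ?b = "\<lambda>i. fps_nth (\<phi>$i) 1"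
  define p where "p = Z$0"
  have p: "p \<noteq> 0" using curve_at_infinity(1)[OF Z] by (simp add: p_def)
  have Zp: "Z$0 = p" "Z$1 = p" "Z$3 = p" "Z$2 = 0"
    using curve_at_infinity(2)[OF Z] Z(2) by (simp_all add: coords_eq_iff mu4_O_def p_def)
  have b3: "?b 3 = ?b 1" and b2: "?b 2 = 0" using n(2,3) p by (simp_all add: Zp)
  have b01: "?b 0 \<noteq> ?b 1"
  proof
    assume "?b 0 = ?b 1"
    hence "\<forall>i\<in>UNIV. ?b i = (?b 0 / p) * Z$i"
      unfolding UNIV_4' using b2 b3 p by (simp add: Zp)
    thus False using n(4) by blast
  qed
  have f1: "fps_nth f 1 = ?b 0 + ?b 1" by (simp add: f_def b3[simplified] b2[simplified] c2)
  have f0: "fps_nth f 0 = 0" by (simp add: f_def n Zp c2)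
  have f1': "fps_nth f 1 \<noteq> 0" using b01 unfolding f1 add_eq_0_iff2 .
  thus "f \<noteq> 0" by auto
  show "subdegree f = 1" by (rule subdegreeI[OF f1']) (simp add: f0)
  define d where "d = \<phi>$1 + \<phi>$3"
  have d0: "fps_nth d 0 = 0" and d1: "fps_nth d 1 = 0"
    by (simp_all add: d_def n Zp b3[simplified] c2)
  have e: "(\<phi>$0 + \<phi>$2)^2 = \<phi>$1 * \<phi>$3" "fps_const s * d^2 = \<phi>$0 * \<phi>$2"
    using \<phi> by (simp_all add: mu4_local_param_def mu4_eqs_def d_def)
  \<comment> \<open>The first quadric solved for the square of \<open>X0 + X1\<close>: its
    \<open>t^2\<close> coefficient ties that of \<open>d\<close> to the nonzero square of
    \<open>?b 0 + ?b 1\<close>.\<close>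
  have "(\<phi>$0 + \<phi>$1)^2 = \<phi>$1 * d + \<phi>$2^2"
  proof -
    note c2f = char2_simps[OF two_fps]
    have "(\<phi>$0 + \<phi>$1)^2 = (\<phi>$0 + \<phi>$2)^2 + \<phi>$1 * \<phi>$1 + \<phi>$2^2"
      by (simp add: power2_eq_square algebra_simps c2f)
    also have "\<dots> = \<phi>$1 * d + \<phi>$2^2" unfolding e(1) by (simp add: d_def algebra_simps)
    finally show ?thesis .
  qed
  from arg_cong[OF this, of "\<lambda>f. fps_nth f 2"]
  have "(?b 0 + ?b 1)^2 = p * fps_nth d 2"
    by (simp add: power2_eq_square fps_mult_nth numeral_2_eq_2 n Zp b2[simplified] d0 d1[simplified] c2)
  hence d2: "fps_nth d 2 \<noteq> 0" using b01 by (auto simp: add_eq_0_iff2)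
  from arg_cong[OF e(2), of "\<lambda>f. fps_nth f 2"]
  have "p * fps_nth (\<phi>$2) 2 = 0"
    by (simp add: power2_eq_square fps_mult_nth numeral_2_eq_2 n Zp b2[simplified] d0 d1[simplified] c2)
  hence z2: "fps_nth (\<phi>$2) 2 = 0" using p by simp
  have v: "v = d + fps_const l * \<phi>$2" by (simp add: v_def d_def)
  have v2: "fps_nth v 2 \<noteq> 0" using d2 z2 by (simp add: v)
  thus "v \<noteq> 0" by auto
  show "subdegree v = 2"
  proof (rule subdegreeI[OF v2])
    fix i :: nat assume "i < 2"
    hence "i = 0 \<or> i = 1" by auto
    thus "fps_nth v i = 0" using d0 d1 b2 n(1) Zp by (auto simp: v)
  qed
qed

end

section \<open>The divisor of a line divided by a vertical line\<close>

context mu4_char2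
begin

lemma same_point_affine_infinity: "Z$2 = 0 \<Longrightarrow> \<not> same_point (mu4_affine s l w) Z"
  by (auto simp: same_point_def mu4_affine_def)

lemma same_point_affine_iff:
  assumes "q \<noteq> 0"
  shows "same_point (mu4_affine s l w) (q *s mu4_affine s l' w') \<longleftrightarrow> l = l' \<and> w = w'"
proof
  assume "same_point (mu4_affine s l w) (q *s mu4_affine s l' w')"
  then obtain c where c: "q *s mu4_affine s l' w' = c *s mu4_affine s l w"
    by (auto simp: same_point_def)
  hence "q = c" by (simp add: coords_eq_iff mu4_affine_def)
  with c assms show "l = l' \<and> w = w'" by (auto simp: coords_eq_iff mu4_affine_def)
next
  assume "l = l' \<and> w = w'"
  thus "same_point (mu4_affine s l w) (q *s mu4_affine s l' w')"
    using assms by (auto simp: same_point_def)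
qed

text \<open>\<open>L3\<close> puts \<open>-R = (l3, w3 + l3)\<close> on the line. As
  \<open>l1\<close>, \<open>l2\<close>, \<open>l3\<close> are distinct and nonzero, all
  intersections are simple and the norm determines every order. The vertical line vanishes at
  \<open>R\<close> and \<open>-R\<close>; its zero at \<open>-R\<close> cancels against the line,
  which leaves the pole at \<open>R\<close>.\<close>

lemma line_div:
  assumes E1: "w1^2 + l1 * w1 = s * l1^3 + 1" and E2: "w2^2 + l2 * w2 = s * l2^3 + 1"
    and E3: "w3^2 + l3 * w3 = s * l3^3 + 1"
    and ne: "l1 \<noteq> l2" "l1 \<noteq> l3" "l2 \<noteq> l3" and nz: "l1 \<noteq> 0" "l2 \<noteq> 0" "l3 \<noteq> 0"
    and L1: "w1 = a * l1 + b" and L2: "w2 = a * l2 + b" and L3: "w3 + l3 = a * l3 + b"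
  shows "mu4_div_eq s 1 (linear_form (vec4 1 (1 + a) b a)) (linear_form (vec4 0 1 l3 1))
    (\<lambda>Z. point_div (mu4_affine s l1 w1) Z + point_div (mu4_affine s l2 w2) Z
       - point_div (mu4_affine s l3 w3) Z - point_div mu4_O Z)"
  unfolding mu4_div_eq_def
proof (intro ballI allI impI)
  have root: "s * l^3 + (a^2 + a) * l^2 + b * l + (1 + b^2) = 0"
    if "(a * l + b)^2 + l * (a * l + b) = s * l^3 + 1" for l
  proof -
    have "s * l^3 + (a^2 + a) * l^2 + b * l + (1 + b^2) =
        s * l^3 + 1 + ((a * l + b)^2 + l * (a * l + b))"
      by (simp add: power2_sum two power_mult_distrib) (simp add: power2_eq_square algebra_simps)
    thus ?thesis unfolding that c2 .
  qed
  have E3': "(w3 + l3)^2 + l3 * (w3 + l3) = s * l3^3 + 1"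
    using E3 by (simp add: power2_eq_square algebra_simps c2)
  note k = cubic_roots_coeffs[OF root root root ne, OF E1[unfolded L1] E2[unfolded L2] E3'[unfolded L3]]
  have k1: "s * (l1 + l2 + l3) = a^2 + a" and k2: "s * (l1 * l2 + l1 * l3 + l2 * l3) = b"
    and k3: "s * (l1 * l2 * l3) = 1 + b^2"
    using k unfolding c2 by simp_all
  fix Z \<phi> assume Z: "Z \<in> mu4_curve s" and \<phi>: "mu4_local_param s Z \<phi>"
  note n = local_param_nth[OF \<phi>]
  define f where "f = \<phi>$0 + \<phi>$1 + fps_const a * (\<phi>$1 + \<phi>$3) + fps_const b * \<phi>$2"
  define v where "v l = \<phi>$1 + \<phi>$3 + fps_const l * \<phi>$2" for l
  have f: "form_eval fps_const 1 (linear_form (vec4 1 (1 + a) b a)) \<phi> = f"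
    unfolding form_eval_linear_form by (simp add: f_def algebra_simps flip: fps_const_add)
  have g: "form_eval fps_const 1 (linear_form (vec4 0 1 l3 1)) \<phi> = v l3"
    unfolding form_eval_linear_form by (simp add: v_def algebra_simps)
  let ?D = "point_div (mu4_affine s l1 w1) Z + point_div (mu4_affine s l2 w2) Z
       - point_div (mu4_affine s l3 w3) Z - point_div mu4_O Z"
  have "f \<noteq> 0 \<and> v l3 \<noteq> 0 \<and> int (subdegree f) - int (subdegree (v l3)) = ?D"
  proof (cases "Z$2 = 0")
    case True
    have "same_point mu4_O Z"
      using curve_at_infinity[OF Z True] by (auto simp: same_point_def)
    hence "?D = -1" by (simp add: point_div_def same_point_affine_infinity[OF True])
    thus ?thesis
      using subdegree_at_infinity[OF \<phi> Z True] unfolding f_def v_def by simp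
  next
    case False
    obtain l w where lw: "Z = Z$2 *s mu4_affine s l w" and E: "w^2 + l * w = s * l^3 + 1"
      using curve_affineE[OF Z False] .
    define q where "q = Z$2"
    have q: "q \<noteq> 0" using False by (simp add: q_def)
    have Zc: "Z$0 = q * (s * l^2)" "Z$1 = q * (w + s * l^2)" "Z$2 = q" "Z$3 = q * (w + s * l^2 + l)"
      using lw by (simp_all add: coords_eq_iff mu4_affine_def flip: q_def)
    have Zl: "Z$1 + Z$3 = q * l" and Zw: "Z$0 + Z$1 = q * w"
      unfolding Zc by (simp_all add: c2 add.assoc add.left_commute flip: distrib_left)
    have vl: "v t \<noteq> 0" "subdegree (v t) = of_bool (l = t)" if "t \<noteq> 0" for t
      using subdegree_vertical[OF \<phi> False that] q unfolding v_def Zl Zc(3) by auto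
    have phi: "mu4_eqs (fps_const s) \<phi>" using \<phi> by (simp add: mu4_local_param_def)
    \<comment> \<open>The conjugate line, that is, \<open>f\<close> composed with negation.\<close>
    define f' where "f' = f + (\<phi>$1 + \<phi>$3)"
    have fc: "fps_const s * (fps_const l1 + fps_const l2 + fps_const l3) = fps_const a^2 + fps_const a"
      "fps_const s * (fps_const l1 * fps_const l2 + fps_const l1 * fps_const l3 + fps_const l2 * fps_const l3)
        = fps_const b"
      "fps_const s * (fps_const l1 * fps_const l2 * fps_const l3) = 1 + fps_const b^2"
      by (simp_all add: k1 k2 k3 fps_const_power fps_const_mult flip: fps_const_1_eq_1)
    have prod: "f * f' * \<phi>$2 = fps_const s * (v l1 * v l2 * v l3)"
      unfolding f'_def v_def by (rule mu4_line_norm[OF two_fps phi fc f_def])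
    hence nz': "f \<noteq> 0" "f' \<noteq> 0" "\<phi>$2 \<noteq> 0" using vl nz s_nz by auto
    have "subdegree f + subdegree f' + subdegree (\<phi>$2) =
        subdegree (v l1) + subdegree (v l2) + subdegree (v l3)"
      using arg_cong[OF prod, of subdegree] nz' vl(1) nz s_nz by simp
    moreover have "subdegree (\<phi>$2) = 0" using n(1) False by simp
    ultimately have sub: "subdegree f + subdegree f' = of_bool (l = l1) + of_bool (l = l2) + of_bool (l = l3)"
      using vl(2) nz by simp
    have f0: "fps_nth f 0 = q * (w + (a * l + b))"
    proof -
      have "fps_nth f 0 = (Z$0 + Z$1) + a * (Z$1 + Z$3) + b * Z$2" by (simp add: f_def n)
      thus ?thesis unfolding Zl Zw Zc(3) by (simp add: algebra_simps)
    qed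
    have f'0: "fps_nth f' 0 = q * (w + (a * l + b) + l)"
    proof -
      have "fps_nth f' 0 = fps_nth f 0 + (Z$1 + Z$3)" by (simp add: f'_def n)
      thus ?thesis unfolding f0 Zl by (simp add: algebra_simps)
    qed
    have on_line: "l = l1 \<or> l = l2 \<or> l = l3" if "w = a * l + b"
    proof -
      have "s * ((l + l1) * (l + l2) * (l + l3)) =
          s * l^3 + s * (l1 + l2 + l3) * l^2 + s * (l1 * l2 + l1 * l3 + l2 * l3) * l + s * (l1 * l2 * l3)"
        by (simp add: power2_eq_square power3_eq_cube algebra_simps)
      also have "\<dots> = 0"
        unfolding k1 k2 k3 by (rule root) (use E that in simp)
      finally show ?thesis using s_nz by (auto simp: add_eq_0_iff2)
    qed
    \<comment> \<open>On the line, \<open>f'\<close> takes the value \<open>q * l\<close>, which is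
      nonzero, so \<open>f\<close> carries the whole order of the norm; off the line
      \<open>f\<close> is a unit.\<close>
    have subf: "subdegree f = of_bool (w = a * l + b)"
    proof (cases "w = a * l + b")
      case True
      have "l \<noteq> 0" using on_line[OF True] nz by auto
      hence "fps_nth f' 0 \<noteq> 0" using q by (simp add: f'0 c2 True)
      hence "subdegree f' = 0" by simp
      thus ?thesis using sub on_line[OF True] True ne by auto
    next
      case False
      hence "fps_nth f 0 \<noteq> 0" using q by (simp add: f0 add_eq_0_iff2)
      thus ?thesis using False by simp
    qed
    have pd: "point_div (mu4_affine s l' w') Z = of_bool (l' = l \<and> w' = w)" for l' w'
      using same_point_affine_iff[OF q, of l' w' l w] lw by (simp add: point_div_def flip: q_def)
    have "\<not> same_point mu4_O Z" using False by (auto simp: same_point_def mu4_O_def)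
    hence D: "?D = of_bool (l1 = l \<and> w1 = w) + of_bool (l2 = l \<and> w2 = w) - of_bool (l3 = l \<and> w3 = w)"
      by (simp add: pd) (simp add: point_div_def)
    \<comment> \<open>The points over \<open>l3\<close> are \<open>R\<close> and
      \<open>-R\<close>.\<close>
    have two_w: "w = w3 \<or> w = w3 + l3" if "l = l3"
    proof -
      have "(w + w3) * (w + (w3 + l3)) = (w^2 + l3 * w) + (w3^2 + l3 * w3)"
        by (simp add: power2_eq_square algebra_simps c2)
      also have "\<dots> = 0" using E E3 that by (simp add: c2)
      finally show ?thesis by (auto simp: add_eq_0_iff2)
    qed
    have "w3 \<noteq> w3 + l3" using nz by simp
    hence "int (of_bool (w = a * l + b)) - int (of_bool (l = l3)) = ?D"
      unfolding D using on_line two_w L1 L2 L3 ne by auto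
    thus ?thesis using nz'(1) vl nz by (simp add: subf)
  qed
  thus "form_eval fps_const 1 (linear_form (vec4 1 (1 + a) b a)) \<phi> \<noteq> 0 \<and>
      form_eval fps_const 1 (linear_form (vec4 0 1 l3 1)) \<phi> \<noteq> 0 \<and>
      int (subdegree (form_eval fps_const 1 (linear_form (vec4 1 (1 + a) b a)) \<phi>)) -
      int (subdegree (form_eval fps_const 1 (linear_form (vec4 0 1 l3 1)) \<phi>)) = ?D"
    unfolding f g .
qed

end

section \<open>Generic pairs: correctness of the sum, and existence\<close>

text \<open>Its nonvanishing provides the hypotheses of \<open>line_div\<close>: none of the three
  points is at infinity or fixed by negation (\<open>l = 0\<close>), and their \<open>l\<close> are
  pairwise distinct.\<close>

definition mu4_generic :: "'a::comm_ring_1^4 \<Rightarrow> 'a^4 \<Rightarrow> 'a" where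
  "mu4_generic x y = (let z = mu4_add x y in
     x$2 * y$2 * z$2 * (x$1 + x$3) * (y$1 + y$3) * (z$1 + z$3)
     * ((x$1 + x$3) * y$2 + (y$1 + y$3) * x$2)
     * ((x$1 + x$3) * z$2 + (z$1 + z$3) * x$2)
     * ((y$1 + y$3) * z$2 + (z$1 + z$3) * y$2))"

lemma mu4_add_scale: "mu4_add (p *s x) (q *s y) = (p * q)^2 *s mu4_add x y"
  by (simp add: mu4_add_def coords_eq_iff power2_eq_square algebra_simps)

lemma same_point_scale:
  assumes "q \<noteq> 0"
  shows "same_point (q *s x) z \<longleftrightarrow> same_point x z"
proof
  assume "same_point (q *s x) z"
  then obtain c where "c \<noteq> 0" "z = c *s (q *s x)" by (auto simp: same_point_def)
  thus "same_point x z" using assms by (auto simp: same_point_def vector_smult_assoc intro!: exI[of _ "c * q"])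
next
  assume "same_point x z"
  then obtain c where "c \<noteq> 0" "z = c *s x" by (auto simp: same_point_def)
  thus "same_point (q *s x) z" using assms by (auto simp: same_point_def vector_smult_assoc intro!: exI[of _ "c / q"])
qed

text \<open>Scaling reduces to affine representatives; there \<open>mu4_add_collinear\<close> shows
  that the chord through \<open>P\<close> and \<open>Q\<close> passes through \<open>-R\<close>, as
  \<open>line_div\<close> requires.\<close>

lemma mu4_is_sum_add:
  fixes s :: "'a::alg_closed_field"
  assumes char: "CHAR('a) = 2" and s: "s \<noteq> 0"
    and x: "x \<in> mu4_curve s" and y: "y \<in> mu4_curve s" and xy: "mu4_generic x y \<noteq> 0"
  shows "mu4_is_sum s x y (mu4_add x y)"
proof -
  interpret mu4_char2 s by unfold_locales (fact char s)+
  define z where "z = mu4_add x y"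
  have nz: "x$2 \<noteq> 0" "y$2 \<noteq> 0" "z$2 \<noteq> 0"
    "x$1 + x$3 \<noteq> 0" "y$1 + y$3 \<noteq> 0" "z$1 + z$3 \<noteq> 0"
    "(x$1 + x$3) * y$2 + (y$1 + y$3) * x$2 \<noteq> 0"
    "(x$1 + x$3) * z$2 + (z$1 + z$3) * x$2 \<noteq> 0"
    "(y$1 + y$3) * z$2 + (z$1 + z$3) * y$2 \<noteq> 0"
    using xy by (simp_all add: mu4_generic_def Let_def flip: z_def)
  have z: "z \<in> mu4_curve s"
    using mu4_eqs_add[of x y] x y nz(3) by (auto simp: mu4_curve_def z_def)
  obtain l1 w1 where x': "x = x$2 *s mu4_affine s l1 w1" and E1: "w1^2 + l1 * w1 = s * l1^3 + 1"
    using curve_affineE[OF x nz(1)] .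
  obtain l2 w2 where y': "y = y$2 *s mu4_affine s l2 w2" and E2: "w2^2 + l2 * w2 = s * l2^3 + 1"
    using curve_affineE[OF y nz(2)] .
  obtain l3 w3 where z': "z = z$2 *s mu4_affine s l3 w3" and E3: "w3^2 + l3 * w3 = s * l3^3 + 1"
    using curve_affineE[OF z nz(3)] .
  \<comment> \<open>The second equation reads off \<open>w + l\<close>, the
    \<open>w\<close>-coordinate of the negative point.\<close>
  have aff: "v$1 + v$3 = v$2 * l" "v$0 + v$3 = v$2 * (w + l)"
    if "v = v$2 *s mu4_affine s l w" for v l w
  proof -
    have e: "v$0 = v$2 * (s * l^2)" "v$1 = v$2 * (w + s * l^2)" "v$3 = v$2 * (w + s * l^2 + l)"
      using arg_cong[OF that, of "\<lambda>v. v$0"] arg_cong[OF that, of "\<lambda>v. v$1"]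
        arg_cong[OF that, of "\<lambda>v. v$3"] by (simp_all add: mu4_affine_def)
    have "w + s * l^2 + (w + s * l^2 + l) = l" "s * l^2 + (w + s * l^2 + l) = w + l"
      by (simp_all only: add.assoc add.commute add.left_commute c2 add_0_left)
    thus "v$1 + v$3 = v$2 * l" "v$0 + v$3 = v$2 * (w + l)"
      unfolding e by (simp_all only: distrib_left[symmetric])
  qed
  note ax = aff[OF x'] and ay = aff[OF y'] and az = aff[OF z']
  have lnz: "l1 \<noteq> 0" "l2 \<noteq> 0" "l3 \<noteq> 0" using nz(4-6) unfolding ax ay az by auto
  have lne: "l1 \<noteq> l2" "l1 \<noteq> l3" "l2 \<noteq> l3"
    using nz(7-9) unfolding ax ay az by (auto simp: add_eq_0_iff2)
  define z0 where "z0 = mu4_add (mu4_affine s l1 w1) (mu4_affine s l2 w2)"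
  define k where "k = (x$2 * y$2)^2"
  have zz: "z$i = k * z0$i" for i
    unfolding z_def k_def z0_def by (subst x', subst y', subst mu4_add_scale) simp
  have "(w1 + w2) * (l1 * z$2 + (z$1 + z$3)) = k * ((w1 + w2) * (l1 * z0$2 + (z0$1 + z0$3)))"
    unfolding zz by (simp add: algebra_simps)
  also have "\<dots> = k * ((w1 * z0$2 + (z0$0 + z0$3)) * (l1 + l2))"
    unfolding mu4_add_collinear[OF two E1 E2 z0_def] ..
  also have "\<dots> = (w1 * z$2 + (z$0 + z$3)) * (l1 + l2)"
    unfolding zz by (simp add: algebra_simps)
  finally have "z$2 * ((w1 + w2) * (l1 + l3)) = z$2 * ((w1 + (w3 + l3)) * (l1 + l2))"
    unfolding az by (simp add: algebra_simps)
  hence col: "(w1 + w2) * (l1 + l3) = (w1 + (w3 + l3)) * (l1 + l2)" using nz(3) by simp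
  define a where "a = (w1 + w2) / (l1 + l2)"
  define b where "b = w1 + a * l1"
  have l12: "l1 + l2 \<noteq> 0" using lne by (simp add: add_eq_0_iff2)
  have L1: "w1 = a * l1 + b" by (simp add: b_def add.left_commute c2)
  have "a * l2 + b = w1 + a * (l1 + l2)" by (simp add: b_def algebra_simps)
  hence L2: "w2 = a * l2 + b" using l12 by (simp add: a_def c2)
  have "a * l3 + b = w1 + a * (l1 + l3)" by (simp add: b_def algebra_simps)
  also have "a * (l1 + l3) = w1 + (w3 + l3)" using l12 col by (simp add: a_def)
  finally have L3: "w3 + l3 = a * l3 + b" by (simp add: c2)
  have pd: "point_div x = point_div (mu4_affine s l1 w1)" "point_div y = point_div (mu4_affine s l2 w2)"
    "point_div z = point_div (mu4_affine s l3 w3)"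
    using same_point_scale[OF nz(1), of "mu4_affine s l1 w1"] same_point_scale[OF nz(2), of "mu4_affine s l2 w2"]
      same_point_scale[OF nz(3), of "mu4_affine s l3 w3"]
    by (simp_all add: point_div_def fun_eq_iff flip: x' y' z')
  show ?thesis
    unfolding mu4_is_sum_def z_def[symmetric] pd
    by (intro conjI x y z exI) (rule line_div[OF E1 E2 E3 lne lnz L1 L2 L3])
qed

text \<open>A point \<open>y\<close> with a zero coordinate keeps the sum simple enough to evaluate
  all nine factors by hand.\<close>

lemma mu4_generic_pair_exists:
  fixes s :: "'a::alg_closed_field"
  assumes char: "CHAR('a) = 2" and s: "s \<noteq> 0"
  shows "\<exists>x\<in>mu4_curve s. \<exists>y\<in>mu4_curve s. mu4_generic x y \<noteq> 0"
proof -
  interpret mu4_char2 s by unfold_locales (fact char s)+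
  have quadratic: "\<exists>t::'a. t^2 + p * t = q" for p q
  proof -
    obtain t where "poly [:q, p, 1:] t = 0"
      using alg_closed_imp_poly_has_root[of "[:q, p, 1:]"] by auto
    hence "q + (t^2 + p * t) = 0" by (simp add: power2_eq_square algebra_simps)
    thus ?thesis by (auto simp: add_eq_0_iff2)
  qed
  obtain r where r: "r^2 = s" using quadratic[of 0 s] by auto
  hence r0: "r \<noteq> 0" using s by auto
  \<comment> \<open>A primitive cube root of unity; what matters below is that it differs from 0 and
    1.\<close>
  obtain u :: 'a where u: "u^2 + 1 * u = 1" using quadratic by blast
  have u0: "u \<noteq> 0" and u1: "u \<noteq> 1" using u by (auto simp: c2)
  have uu: "1 + u^2 \<noteq> 0" using u1 by (metis add_eq_0_iff2 power2_eq_1_iff c2(3))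
  \<comment> \<open>This makes \<open>s * l^2\<close> equal to \<open>u^2\<close>, and differs from
    the value \<open>1 / r\<close> of \<open>l\<close> at \<open>y\<close>.\<close>
  define l where "l = u / r"
  have lr: "r * l = u" using r0 by (simp add: l_def)
  have l0: "l \<noteq> 0" using u0 r0 by (simp add: l_def)
  have sl: "s * l^2 = u^2" by (simp flip: r lr add: power_mult_distrib)
  obtain w' where w': "w'^2 + l * w' = s * l^3 + 1" using quadratic by blast
  \<comment> \<open>\<open>ndbl\<close> says \<open>2 x \<noteq> - y\<close>; it fails for at most one of the two points over \<open>l\<close>\<close>
  obtain w where w: "w^2 + l * w = s * l^3 + 1" and ndbl: "u * (w + u^2 + l) + (1 + u^2) \<noteq> 0"
  proof (cases "u * (w' + u^2 + l) + (1 + u^2) = 0")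
    case True
    have "(w' + l)^2 + l * (w' + l) = s * l^3 + 1"
      using w' by (simp add: power2_eq_square algebra_simps c2)
    moreover have "u * (w' + l + u^2 + l) + (1 + u^2) = (u * (w' + u^2 + l) + (1 + u^2)) + u * l"
      by (simp add: algebra_simps)
    ultimately show ?thesis using that[of "w' + l"] True u0 l0 by simp
  next
    case False
    thus ?thesis using that w' by blast
  qed
  define x where "x = mu4_affine s l w"
  define y where "y = vec4 r 0 r 1" \<comment> \<open>a point of order 4; adding it permutes coordinates up to scaling\<close>
  have xeq: "mu4_eqs s x"
    unfolding x_def mu4_affine_def by (rule mu4_eqs_affine[OF two w])
  have xs: "x$0 = u^2" "x$1 = w + u^2" "x$2 = 1" "x$3 = w + u^2 + l"
    by (simp_all add: x_def mu4_affine_def sl)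
  have x: "x \<in> mu4_curve s" using xeq xs by (auto simp: mu4_curve_def)
  have y: "y \<in> mu4_curve s"
    using r r0 by (auto simp: mu4_curve_def mu4_eqs_def y_def coords_eq_iff c2 power2_eq_square)
  have x3: "x$3 \<noteq> 0"
  proof
    assume "x$3 = 0"
    hence "(u^2 + 1)^2 = 0" using xeq by (simp add: mu4_eqs_def xs)
    thus False using uu by (simp add: add.commute)
  qed
  \<comment> \<open>Up to the nonzero factor \<open>r * u^2\<close> this is the condition that
    \<open>y\<close> and the sum have different \<open>l\<close>.\<close>
  have wl: "w + l + 1 \<noteq> 0"
  proof
    assume "w + l + 1 = 0"
    hence "w = l + 1" by (simp add: add_eq_0_iff2 add.assoc)
    hence "(l + 1)^2 + l * (l + 1) = s * l^3 + 1" using w by simp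
    moreover have "(l + 1)^2 + l * (l + 1) = l + 1"
      by (simp add: power2_eq_square algebra_simps c2)
    moreover have "s * l^3 = u^2 * l"
      unfolding sl[symmetric] by (simp add: power2_eq_square power3_eq_cube)
    ultimately have "u^2 = 1" using l0 by simp
    thus False using uu by (simp add: c2)
  qed
  have Lx: "x$1 + x$3 = l" by (simp add: xs algebra_simps c2)
  define z where "z = mu4_add x y"
  have z2: "z$2 = r * u^2 * x$3" by (simp add: z_def mu4_add_def y_def xs)
  have Lz: "z$1 + z$3 = u^2 * (1 + u^2)"
  proof -
    have "z$1 = (r * (x$1 + x$3))^2" "z$3 = (u^2)^2"
      by (simp_all add: z_def mu4_add_def y_def xs algebra_simps)
    thus ?thesis unfolding Lx lr by (simp add: power2_eq_square algebra_simps)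
  qed
  have "(x$1 + x$3) * y$2 + (y$1 + y$3) * x$2 = u + 1"
    unfolding Lx by (simp add: y_def xs mult.commute[of l] lr)
  hence 1: "(x$1 + x$3) * y$2 + (y$1 + y$3) * x$2 \<noteq> 0" using u1 by (simp add: add_eq_0_iff2)
  have "(x$1 + x$3) * z$2 + (z$1 + z$3) * x$2 = u^2 * (u * (w + u^2 + l) + (1 + u^2))"
    unfolding Lx Lz unfolding z2 xs(3,4) lr[symmetric] by (simp add: algebra_simps)
  hence 2: "(x$1 + x$3) * z$2 + (z$1 + z$3) * x$2 \<noteq> 0" using u0 ndbl by simp
  have "(y$1 + y$3) * z$2 + (z$1 + z$3) * y$2 = r * u^2 * (w + u^2 + l + (1 + u^2))"
    unfolding Lz unfolding z2 xs(4) by (simp add: y_def algebra_simps)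
  also have "w + u^2 + l + (1 + u^2) = w + l + 1" by (simp add: algebra_simps c2)
  finally have 3: "(y$1 + y$3) * z$2 + (z$1 + z$3) * y$2 \<noteq> 0" using r0 u0 wl by simp
  have "y$2 \<noteq> 0" "y$1 + y$3 \<noteq> 0" "z$2 \<noteq> 0" "z$1 + z$3 \<noteq> 0" "x$2 \<noteq> 0" "x$1 + x$3 \<noteq> 0"
    using r0 u0 x3 uu l0 by (simp_all add: y_def z2 Lz Lx xs(3))
  hence "mu4_generic x y \<noteq> 0"
    unfolding mu4_generic_def Let_def z_def[symmetric] using 1 2 3 by simp
  thus ?thesis using x y by blast
qed

text \<open>For \<open>s = 0\<close> the second quadric degenerates to \<open>X0 X2\<close>, whose
  gradient vanishes at the curve point \<open>(0:1:0:0)\<close>.\<close>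

lemma mu4_nonsingular_nonzero:
  fixes s :: "'k::field"
  assumes "mu4_nonsingular s"
  shows "s \<noteq> 0"
proof
  assume "s = 0"
  hence "vec4 0 1 0 0 \<in> mu4_curve (to_ac s)"
    by (simp add: mu4_curve_def mu4_eqs_def coords_eq_iff)
  moreover have "0 *s mu4_grad1 (vec4 0 1 0 0) + 1 *s mu4_grad2 (to_ac s) (vec4 0 1 0 0) = 0"
    using \<open>s = 0\<close> by (simp add: mu4_grad2_def coords_eq_iff)
  ultimately show False using assms unfolding mu4_nonsingular_def by (metis zero_neq_one)
qed

section \<open>Bihomogeneous forms with coefficients in the base field\<close>

text \<open>Keeping the coefficients existential lets closure under sums and products replace an
  explicit expansion of \<open>mu4_generic\<close>.\<close>

definition is_biform ::
    "nat \<Rightarrow> nat \<Rightarrow> ('k::field alg_closure^4 \<Rightarrow> 'k alg_closure^4 \<Rightarrow> 'k alg_closure) \<Rightarrow> bool" where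
  "is_biform d e F \<longleftrightarrow>
     (\<exists>f :: (4 \<Rightarrow> nat) \<Rightarrow> (4 \<Rightarrow> nat) \<Rightarrow> 'k. \<forall>x y. biform_eval to_ac d e f x y = F x y)"

lemma biform_eval_pairs:
  "biform_eval h d e f x y =
     (\<Sum>p\<in>exps d \<times> exps e. h (f (fst p) (snd p)) * (monom4 x (fst p) * monom4 y (snd p)))"
  by (simp add: biform_eval_def sum.cartesian_product case_prod_beta mult.assoc)

lemma is_biform_fst: "is_biform 1 0 (\<lambda>(x :: 'k::field alg_closure^4) y. x$i)"
proof -
  have "exps 0 = {\<lambda>_. 0}" by (auto simp: exps_def)
  moreover have "(\<Sum>j\<in>UNIV. to_ac (of_bool (unit_exp j = unit_exp i)) * x$j) = x$i"
    for x :: "'k alg_closure^4"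
  proof -
    have "(\<Sum>j\<in>UNIV. to_ac (of_bool (unit_exp j = unit_exp i)) * x$j) =
        (\<Sum>j\<in>UNIV. if j = i then x$j else 0)"
      by (rule sum.cong) (auto simp: inj_eq[OF inj_unit_exp])
    thus ?thesis by simp
  qed
  ultimately show ?thesis
    unfolding is_biform_def biform_eval_def exps_1
    by (intro exI[of _ "\<lambda>\<alpha> \<beta>. of_bool (\<alpha> = unit_exp i)"])
       (simp add: sum.reindex[OF inj_unit_exp] monom4_unit_exp, simp add: monom4_def)
qed

lemma is_biform_snd: "is_biform 0 1 (\<lambda>(x :: 'k::field alg_closure^4) y. y$i)"
proof -
  obtain f :: "(4 \<Rightarrow> nat) \<Rightarrow> (4 \<Rightarrow> nat) \<Rightarrow> 'k"
    where f: "\<And>x y. biform_eval to_ac 1 0 f x y = x$i"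
    using is_biform_fst[of i] by (auto simp: is_biform_def)
  have "biform_eval to_ac 0 1 (\<lambda>\<alpha> \<beta>. f \<beta> \<alpha>) x y = y$i" for x y :: "'k alg_closure^4"
    unfolding f[of y x, symmetric] biform_eval_def
    by (subst sum.swap) (simp add: ac_simps)
  thus ?thesis by (auto simp: is_biform_def)
qed

lemma is_biform_add:
  assumes "is_biform d e F" "is_biform d e G"
  shows "is_biform d e (\<lambda>x y. F x y + G x y)"
proof -
  obtain f g where "\<And>x y. biform_eval to_ac d e f x y = F x y" "\<And>x y. biform_eval to_ac d e g x y = G x y"
    using assms by (auto simp: is_biform_def)
  moreover have "biform_eval to_ac d e (\<lambda>\<alpha> \<beta>. f \<alpha> \<beta> + g \<alpha> \<beta>) x y =
      biform_eval to_ac d e f x y + biform_eval to_ac d e g x y" for x y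
    by (simp add: biform_eval_def distrib_right sum.distrib)
  ultimately show ?thesis by (auto simp: is_biform_def)
qed

text \<open>Coefficients convolve: \<open>h\<close> sums over the pairs of exponents that
  \<open>pl\<close> adds to \<open>(\<gamma>, \<delta>)\<close>, and the product of sums is
  regrouped along the fibres of \<open>pl\<close>.\<close>

lemma is_biform_mult:
  assumes "is_biform d e F" "is_biform d' e' G"
  shows "is_biform (d + d') (e + e') (\<lambda>x y. F x y * G x y)"
proof -
  obtain f g where f: "\<And>x y. biform_eval to_ac d e f x y = F x y"
    and g: "\<And>x y. biform_eval to_ac d' e' g x y = G x y"
    using assms by (auto simp: is_biform_def)
  define A B C where "A = exps d \<times> exps e" and "B = exps d' \<times> exps e'"
    and "C = exps (d + d') \<times> exps (e + e')"
  define pl :: "((4 \<Rightarrow> nat) \<times> (4 \<Rightarrow> nat)) \<times> (4 \<Rightarrow> nat) \<times> (4 \<Rightarrow> nat) \<Rightarrow> (4 \<Rightarrow> nat) \<times> (4 \<Rightarrow> nat)"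
    where "pl = (\<lambda>(p, q). (\<lambda>i. fst p i + fst q i, \<lambda>i. snd p i + snd q i))"
  define h where "h \<gamma> \<delta> = (\<Sum>t\<in>{t \<in> A \<times> B. pl t = (\<gamma>, \<delta>)}.
      f (fst (fst t)) (snd (fst t)) * g (fst (snd t)) (snd (snd t)))" for \<gamma> \<delta>
  have "biform_eval to_ac (d + d') (e + e') h x y = F x y * G x y" for x y
  proof -
    define m where "m p = monom4 x (fst p) * monom4 y (snd p)" for p
    have m: "m (pl t) = m (fst t) * m (snd t)" for t
      by (simp add: m_def pl_def case_prod_beta monom4_def power_add prod.distrib ac_simps)
    have fin: "finite (A \<times> B)" "finite C" by (simp_all add: A_def B_def C_def finite_exps)
    have im: "pl ` (A \<times> B) \<subseteq> C"
      by (auto simp: A_def B_def C_def pl_def exps_def sum.distrib)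
    have "F x y * G x y = (\<Sum>t\<in>A \<times> B. to_ac (f (fst (fst t)) (snd (fst t)))
        * to_ac (g (fst (snd t)) (snd (snd t))) * m (pl t))"
      unfolding f[symmetric] g[symmetric] biform_eval_pairs A_def[symmetric] B_def[symmetric]
        sum_product sum.cartesian_product
      by (rule sum.cong) (auto simp: m, simp add: m_def ac_simps)
    also have "\<dots> = (\<Sum>c\<in>C. \<Sum>t\<in>{t \<in> A \<times> B. pl t = c}. to_ac (f (fst (fst t)) (snd (fst t)))
        * to_ac (g (fst (snd t)) (snd (snd t))) * m (pl t))"
      by (rule sum.group[OF fin im, symmetric])
    also have "\<dots> = (\<Sum>c\<in>C. to_ac (h (fst c) (snd c)) * m c)"
      by (rule sum.cong) (auto simp: h_def to_ac_sum sum_distrib_right intro!: sum.cong)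
    finally show ?thesis by (simp add: biform_eval_pairs C_def m_def)
  qed
  thus ?thesis by (auto simp: is_biform_def)
qed

text \<open>The factors have bidegrees (1,0), (0,1), (2,2), (1,0), (0,1), (2,2), (1,1), (3,2),
  (2,3).\<close>

lemma is_biform_generic: "is_biform 12 12 (mu4_generic :: 'k::field alg_closure^4 \<Rightarrow> _)"
proof -
  have x: "is_biform (Suc 0) 0 (\<lambda>(x :: 'k alg_closure^4) y. x$i)" and y: "is_biform 0 (Suc 0) (\<lambda>(x :: 'k alg_closure^4) y. y$i)" for i
    using is_biform_fst is_biform_snd by simp_all
  have xy: "is_biform 1 1 (\<lambda>(x :: 'k alg_closure^4) y. x$i * y$j)" for i j
    using is_biform_mult[OF x y] by simp
  have z: "is_biform 2 2 (\<lambda>(x :: 'k alg_closure^4) y. mu4_add x y $ i)" for i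
  proof -
    have q: "is_biform 2 2 (\<lambda>(x :: 'k alg_closure^4) y. (x$a * y$b) * (x$c * y$d) + (x$a' * y$b') * (x$c' * y$d'))"
      for a b c d a' b' c' d'
      using is_biform_add[OF is_biform_mult[OF xy xy] is_biform_mult[OF xy xy]]
      by (simp add: numeral_2_eq_2)
    have sq: "is_biform 2 2 (\<lambda>(x :: 'k alg_closure^4) y. (x$a * y$b + x$c * y$d)^2)" for a b c d
      using is_biform_mult[OF is_biform_add[OF xy xy] is_biform_add[OF xy xy], of a b c d a b c d]
      by (simp add: power2_eq_square numeral_2_eq_2)
    have "\<forall>i\<in>UNIV. is_biform 2 2 (\<lambda>(x :: 'k alg_closure^4) y. mu4_add x y $ i)"
      unfolding UNIV_4' mu4_add_def by (auto simp: q sq)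
    thus ?thesis by simp
  qed
  have l: "is_biform 1 0 (\<lambda>(x :: 'k alg_closure^4) y. x$1 + x$3)" "is_biform 0 1 (\<lambda>(x :: 'k alg_closure^4) y. y$1 + y$3)"
    "is_biform 2 2 (\<lambda>(x :: 'k alg_closure^4) y. mu4_add x y $ 1 + mu4_add x y $ 3)"
    by (intro is_biform_add is_biform_fst is_biform_snd z)+
  note coord = is_biform_fst[of 2] is_biform_snd[of 2] z[of 2]
  have v: "is_biform 1 1 (\<lambda>(x :: 'k alg_closure^4) y. (x$1 + x$3) * y$2 + (y$1 + y$3) * x$2)"
    "is_biform 3 2 (\<lambda>(x :: 'k alg_closure^4) y. (x$1 + x$3) * mu4_add x y $ 2 + (mu4_add x y $ 1 + mu4_add x y $ 3) * x$2)"
    "is_biform 2 3 (\<lambda>(x :: 'k alg_closure^4) y. (y$1 + y$3) * mu4_add x y $ 2 + (mu4_add x y $ 1 + mu4_add x y $ 3) * y$2)"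
    using is_biform_add[OF is_biform_mult[OF l(1) coord(2)] is_biform_mult[OF coord(1) l(2)]]
      is_biform_add[OF is_biform_mult[OF l(1) coord(3)] is_biform_mult[OF coord(1) l(3)]]
      is_biform_add[OF is_biform_mult[OF l(2) coord(3)] is_biform_mult[OF coord(2) l(3)]]
    by (simp_all add: mult.commute numeral_3_eq_3 numeral_2_eq_2)
  note m = is_biform_mult
  show ?thesis
    using m[OF m[OF m[OF m[OF m[OF m[OF m[OF m[OF coord(1,2)] coord(3)] l(1)] l(2)] l(3)] v(1)] v(2)] v(3)]
    by (simp add: mu4_generic_def[abs_def] Let_def)
qed

section \<open>The straight-line program and its cost\<close>

text \<open>Registers 0 to 7 hold the inputs and 8 to 11 the products \<open>V0\<close> to
  \<open>V3\<close>; 12 and 13 are \<open>V0 + V2\<close> and \<open>V1 + V3\<close>, 16 is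
  \<open>V0 V1 + V2 V3\<close>, and 18 adds to it the product of 12 and 13.\<close>

definition mu4_add_prog :: "'k instr list" where
  "mu4_add_prog =
    [Mult 1 4, Mult 0 7, Mult 3 6, Mult 2 5, Add 8 10, Add 9 11,
     Mult 8 9, Mult 10 11, Add 14 15, Mult 12 13, Add 16 17, Square 12, Square 13]"

definition mu4_add_out :: "4 \<Rightarrow> nat" where
  "mu4_add_out i = (if i = 0 then 16 else if i = 1 then 19 else if i = 2 then 18 else 20)"

text \<open>Characteristic 2 enters only in coordinate 2, where \<open>V0 V1 + V2 V3\<close> occurs
  twice and cancels.\<close>

lemma eval_mu4_add_prog:
  assumes "(2::'a::comm_ring_1) = 0"
  shows "eval_prog h mu4_add_prog mu4_add_out x y = mu4_add x (y :: 'a^4)"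
proof -
  note c = char2_simps[OF assms]
  have "eval_prog h mu4_add_prog mu4_add_out x y $ 2 = mu4_add x y $ 2"
    by (simp add: eval_prog_def mu4_add_prog_def mu4_add_out_def mu4_add_def)
       (simp add: algebra_simps c)
  thus ?thesis
    by (simp add: coords_eq_iff eval_prog_def mu4_add_prog_def mu4_add_out_def mu4_add_def)
qed

theorem corollary28:
  fixes s :: "'k::field"
  assumes "CHAR('k) = 2"
    and "mu4_nonsingular s"
  shows "generic_addition_cost s 7 2"
proof -
  have char: "CHAR('k alg_closure) = 2" using assms(1) by simp
  have two: "(2::'k alg_closure) = 0"
    using of_nat_CHAR[where ?'a = "'k alg_closure"] unfolding char by simp
  have s: "to_ac s \<noteq> 0" using mu4_nonsingular_nonzero[OF assms(2)] by simp
  \<comment> \<open>The complement of the zeros of a single form, so a singleton \<open>S\<close>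
    witnesses openness.\<close>
  define U where "U = {(x, y). x \<in> mu4_curve (to_ac s) \<and> y \<in> mu4_curve (to_ac s) \<and> mu4_generic x y \<noteq> 0}"
  obtain f :: "(4 \<Rightarrow> nat) \<Rightarrow> (4 \<Rightarrow> nat) \<Rightarrow> 'k"
    where "\<And>x y. biform_eval to_ac 12 12 f x y = mu4_generic x y"
    using is_biform_generic by (auto simp: is_biform_def)
  hence "mu4_open_square s U"
    unfolding mu4_open_square_def U_def by (intro exI[of _ "{(12, 12, f)}"]) simp
  moreover have "U \<noteq> {}"
    using mu4_generic_pair_exists[OF char s] by (auto simp: U_def)
  moreover have "\<forall>(x, y)\<in>U. mu4_is_sum (to_ac s) x y (eval_prog to_ac mu4_add_prog mu4_add_out x y)"
    using mu4_is_sum_add[OF char s] by (auto simp: U_def eval_mu4_add_prog[OF two])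
  moreover have "prog_ok 8 (mu4_add_prog :: 'k instr list)" "num_M (mu4_add_prog :: 'k instr list) = 7"
    "num_S (mu4_add_prog :: 'k instr list) = 2"
    "\<forall>i. mu4_add_out i < 8 + length (mu4_add_prog :: 'k instr list)"
    by (simp_all add: mu4_add_prog_def num_M_def num_S_def mu4_add_out_def)
  ultimately show ?thesis unfolding generic_addition_cost_def by blast
qed

end
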